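(* Let $n,m,r$ be non-negative integers with $m>n>r$. Then there exist a map $p:\mathbb R^m\to\mathbb R^n$ that is of class $C^k$ for all real $k$ with $0\le k<\frac{m-r}{n-r}$, and a connected set $E\subseteq\mathbb R^m$ consisting of points of rank $r$ of $p$ (i.e. the derivative $Dp(x)$ has rank $r$ for every $x\in E$), such that $p(E)$ contains a nonempty open subset of $\mathbb R^n$.
   Context: Classes $C^k$ for real $k$. Let $f:\mathbb R^m\to\mathbb R^n$ and $\lambda\in(0,1]$. The $\lambda$-partial derivatives $f^{(\lambda)}_1,\dots,f^{(\lambda)}_m$ are defined by $$f_i^{(\lambda)}(a)=\lim_{t\to 0}\operatorname{sign}(t)\,\frac{f(a_1,\dots,a_{i-1},a_i+t,a_{i+1},\dots,a_m)-f(a)}{|t|^\lambda},\qquad a=(a_1,\dots,a_m)\in\mathbb R^m.$$ For $\lambda\in(0,1]$, $f\in C^\lambda$ means that all $\lambda$-partial derivatives of $f$ exist and are continuous; $C^0$ means continuous. For real $k\ge 0$ with integer part $[k]$, $f\in C^k$ means that $f\in C^{[k]}$ (in the usual sense) and every partial derivative of $f$ of order $[k]$ is of class $C^{k-[k]}$. *)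

theory Defs
  imports "HOL-Analysis.Analysis"
begin

text \<open>
  \<open>has_frac_partial l i f d a\<close> says that the \<open>l\<close>-partial derivative of \<open>f\<close> in the coordinate
  direction \<open>i\<close> exists at \<open>a\<close> and equals \<open>d\<close>. For vector-valued \<open>f\<close>, the quotient is a scalar
  multiple.
\<close>
definition has_frac_partial ::
    "real \<Rightarrow> 'm::finite \<Rightarrow> (real^'m \<Rightarrow> real^'n) \<Rightarrow> real^'n \<Rightarrow> real^'m \<Rightarrow> bool" where
  "has_frac_partial l i f d a \<longleftrightarrow>
     ((\<lambda>t. (sgn t / \<bar>t\<bar> powr l) *\<^sub>R (f (a + t *\<^sub>R axis i 1) - f a)) \<longlongrightarrow> d) (at 0)"

text \<open>The class \<open>C\<^sup>l\<close> for \<open>0 \<le> l \<le> 1\<close>; it is not meaningful for other \<open>l\<close>.\<close>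
definition frac_class :: "real \<Rightarrow> (real^'m::finite \<Rightarrow> real^'n) \<Rightarrow> bool" where
  "frac_class l f \<longleftrightarrow>
     (if l = 0 then continuous_on UNIV f
      else \<forall>i. \<exists>g. continuous_on UNIV g \<and> (\<forall>a. has_frac_partial l i f (g a) a))"

definition has_partial ::
    "'m::finite \<Rightarrow> (real^'m \<Rightarrow> real^'n) \<Rightarrow> real^'n \<Rightarrow> real^'m \<Rightarrow> bool" where
  "has_partial i f d a \<longleftrightarrow> ((\<lambda>t. f (a + t *\<^sub>R axis i 1)) has_vector_derivative d) (at 0)"

definition partial :: "'m::finite \<Rightarrow> (real^'m \<Rightarrow> real^'n) \<Rightarrow> real^'m \<Rightarrow> real^'n" where
  "partial i f a = vector_derivative (\<lambda>t. f (a + t *\<^sub>R axis i 1)) (at 0)"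

text \<open>
  Iterated partial derivatives, indexed by the list of coordinate directions; the last element of
  the list is differentiated first. Meaningful only if all the partial derivatives involved exist.
\<close>
primrec iter_partial ::
    "'m::finite list \<Rightarrow> (real^'m \<Rightarrow> real^'n) \<Rightarrow> real^'m \<Rightarrow> real^'n" where
  "iter_partial [] f = f"
| "iter_partial (i # is) f = partial i (iter_partial is f)"

text \<open>Every partial derivative of order at most \<open>j\<close> exists everywhere and is continuous.\<close>
definition nat_class :: "nat \<Rightarrow> (real^'m::finite \<Rightarrow> real^'n) \<Rightarrow> bool" where
  "nat_class j f \<longleftrightarrow>
     (\<forall>is. length is < j \<longrightarrow> (\<forall>i a. \<exists>d. has_partial i (iter_partial is f) d a)) \<and>
     (\<forall>is. length is \<le> j \<longrightarrow> continuous_on UNIV (iter_partial is f))"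

text \<open>The class \<open>C\<^sup>k\<close> for real \<open>k \<ge> 0\<close>.\<close>
definition real_class :: "real \<Rightarrow> (real^'m::finite \<Rightarrow> real^'n) \<Rightarrow> bool" where
  "real_class k f \<longleftrightarrow>
     nat_class (nat \<lfloor>k\<rfloor>) f \<and>
     (\<forall>is. length is = nat \<lfloor>k\<rfloor> \<longrightarrow> frac_class (k - of_int \<lfloor>k\<rfloor>) (iter_partial is f))"

definition point_of_rank :: "(real^'m::finite \<Rightarrow> real^'n::finite) \<Rightarrow> nat \<Rightarrow> real^'m \<Rightarrow> bool" where
  "point_of_rank f r x \<longleftrightarrow> f differentiable (at x) \<and> rank (jacobian f (at x)) = r"

end

theory Submission
  imports Defs "HOL-Real_Asymp.Real_Asymp"
begin

text \<open>
  Put \<open>d = n - r\<close> and \<open>M = m - r\<close>. The first \<open>r\<close> coordinates of the target are copies of coordinates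
  of the source, so what is needed is a map of the remaining \<open>M\<close> coordinates to \<open>\<real>\<^sup>d\<close>, of every class
  below \<open>M / d\<close>, that has derivative zero on a connected set and whose image of that set contains
  a cube.

  The digits. A point of a Cantor set \<open>C \<subseteq> \<real>\<close> with three subcells in each cell is a sequence of ternary
  digits, so a point of \<open>C\<^sup>M\<close> is a single sequence of digits: digit number \<open>N\<close> is the digit of level
  \<open>N div M\<close> of coordinate \<open>N mod M\<close>. Coordinate \<open>j\<close> of the map reads the digits \<open>j, d + j, 2 d + j, \<dots>\<close>
  of this sequence as the ternary expansion of a number in \<open>[-1, 1]\<close>. The image of \<open>C\<^sup>M\<close> is the whole cube,
  because different target coordinates read disjoint sets of digits.

  Smoothness. Digit number \<open>q\<close> of a target coordinate has weight \<open>3\<^sup>-\<^sup>q\<close> and is read at level about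
  \<open>q d / M\<close>, where the gaps of \<open>C\<close> have length \<open>3\<^bsup>- q d / M\<^esup>\<close> up to a polynomial factor (\<open>gap_width_eq\<close>).
  Replacing digits by smooth functions that change only inside the gaps costs about the factor
  \<open>3\<^bsup>q d / M\<^esup>\<close> for each derivative, and at each point of the line only one digit function is not
  constant, so that products cost no more (\<open>digit_product_local_step\<close>). Hence the series of derivatives of order \<open>k\<close> converges for all \<open>k < M / d\<close>, and by interpolation this includes Hoelder
  estimates of fractional order (\<open>series_has_derivative\<close>, \<open>series_Hoelder\<close>). On \<open>C\<^sup>M\<close> all derivatives
  vanish.

  Connectedness. Both \<open>C\<close> and the target use mirrored digits: the middle subcell carries the reversed
  order. Then the two points next to a gap of \<open>C\<close> have digit sequences that differ by one in a single
  place and end in the same constant digit \<open>c\<close>, and the two expansions of a triadic rational are related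
  in the same way. Reading the sequence of all digits as one number gives a map \<open>q\<close> of \<open>C\<^sup>M\<close> onto \<open>[-1, 1]\<close>.
  If \<open>q x = q y\<close> with \<open>x \<noteq> y\<close>, then \<open>x\<close> and \<open>y\<close> differ in one coordinate, in which they face each other
  across a gap (\<open>mirrored_value_triadic_len_ambiguous\<close>, \<open>gap_crossing\<close>). Along the segment from \<open>x\<close> to \<open>y\<close>
  one digit changes, followed by digits \<open>c\<close> only, and the smooth digit functions are chosen so that
  the value of the series stays the same (\<open>signed_series_switch\<close>); hence the derivative is zero on these
  segments as well (\<open>series_partial_across_gap\<close>). The union of \<open>C\<^sup>M\<close> and these segments is connected,
  because \<open>q\<close> maps \<open>C\<^sup>M\<close> onto a connected set and its fibres are joined by the segments
  (\<open>connected_segments_over_fibres\<close>).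
\<close>

section \<open>Smooth functions of one variable\<close>

text \<open>
  The recursion peels off the innermost derivative, so that closure under products and reciprocals
  follows by induction on \<open>n\<close> for all functions at once.
\<close>

primrec times_diff :: "nat \<Rightarrow> (real \<Rightarrow> real) \<Rightarrow> bool" where
  "times_diff 0 f \<longleftrightarrow> True"
| "times_diff (Suc n) f \<longleftrightarrow> (\<forall>x. f differentiable at x) \<and> times_diff n (deriv f)"

lemma times_diff_SucI:
  assumes "\<And>x. (f has_real_derivative f' x) (at x)" "times_diff n f'"
  shows "times_diff (Suc n) f"
proof -
  have "deriv f = f'" using assms(1) by (auto intro: DERIV_imp_deriv)
  then show ?thesis using assms by (auto simp: real_differentiable_def)
qed

lemma times_diff_SucD:
  assumes "times_diff (Suc n) f"
  shows "(f has_real_derivative deriv f x) (at x)" "times_diff n (deriv f)"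
  using assms by (auto simp: DERIV_deriv_iff_real_differentiable)

lemma times_diff_mono: "times_diff (Suc n) f \<Longrightarrow> times_diff n f"
  by (induction n arbitrary: f) auto

lemma times_diff_const: "times_diff n (\<lambda>x. c)"
proof (induction n arbitrary: c)
  case (Suc n)
  show ?case by (rule times_diff_SucI[where f' = "\<lambda>x. 0"]) (auto intro!: Suc.IH)
qed simp

lemma times_diff_add:
  assumes "times_diff n f" "times_diff n g"
  shows "times_diff n (\<lambda>x. f x + g x)"
  using assms
proof (induction n arbitrary: f g)
  case (Suc n)
  show ?case
    by (rule times_diff_SucI[where f' = "\<lambda>x. deriv f x + deriv g x"])
       (auto intro!: derivative_eq_intros times_diff_SucD Suc)
qed simp

lemma times_diff_mult:
  assumes "times_diff n f" "times_diff n g"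
  shows "times_diff n (\<lambda>x. f x * g x)"
  using assms
proof (induction n arbitrary: f g)
  case (Suc n)
  have "times_diff n (\<lambda>x. deriv f x * g x + f x * deriv g x)"
    using Suc.prems times_diff_mono[of n f] times_diff_mono[of n g]
    by (intro times_diff_add Suc.IH) auto
  then show ?case
    by (rule times_diff_SucI[rotated])
       (auto intro!: derivative_eq_intros times_diff_SucD[OF Suc.prems(1)] times_diff_SucD[OF Suc.prems(2)])
qed simp

lemma times_diff_inverse:
  assumes "times_diff n f" "\<And>x. f x \<noteq> 0"
  shows "times_diff n (\<lambda>x. inverse (f x))"
  using assms(1)
proof (induction n)
  case (Suc n)
  have "times_diff n (\<lambda>x. inverse (f x))"
    using Suc times_diff_mono by blast
  then have "times_diff n (\<lambda>x. (-1) * (inverse (f x) * deriv f x * inverse (f x)))"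
    using Suc.prems by (intro times_diff_mult times_diff_const) auto
  then show ?case
    by (rule times_diff_SucI[rotated])
       (auto intro!: derivative_eq_intros times_diff_SucD[OF Suc.prems] simp: assms(2))
qed simp

lemma times_diff_affine:
  assumes "times_diff n f"
  shows "times_diff n (\<lambda>x. f (a * x + b))"
  using assms
proof (induction n arbitrary: f)
  case (Suc n)
  have "times_diff n (\<lambda>x. deriv f (a * x + b) * a)"
    using Suc.prems by (intro times_diff_mult times_diff_const Suc.IH) auto
  moreover have "((\<lambda>x. f (a * x + b)) has_real_derivative deriv f (a * x + b) * a) (at x)" for x
    by (rule DERIV_chain2[OF times_diff_SucD(1)[OF Suc.prems]]) (auto intro!: derivative_eq_intros)
  ultimately show ?case by (rule times_diff_SucI[rotated])
qed simp

text \<open>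
  The derivatives of \<open>exp (- 1 / x)\<close>, extended by zero, are combinations of these functions, which form
  a family that is closed under differentiation.
\<close>

definition flat_exp :: "nat \<Rightarrow> real \<Rightarrow> real" where
  "flat_exp k x = (if x \<le> 0 then 0 else (1 / x) ^ k * exp (- (1 / x)))"

lemma flat_exp_tendsto_0: "(flat_exp k \<longlongrightarrow> 0) (at 0)"
proof -
  have "((\<lambda>x::real. (1 / x) ^ k * exp (- (1 / x))) \<longlongrightarrow> 0) (at_right 0)"
  proof -
    have "filterlim (\<lambda>x::real. 1 / x) at_top (at_right 0)" by real_asymp
    from filterlim_compose[OF tendsto_power_div_exp_0[of k] this]
    show ?thesis by (simp add: exp_minus divide_inverse)
  qed
  then have "(flat_exp k \<longlongrightarrow> 0) (at_right 0)"
    by (rule Lim_transform_eventually) (auto simp: eventually_at_filter flat_exp_def)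
  moreover have "(flat_exp k \<longlongrightarrow> 0) (at_left 0)"
    by (rule Lim_transform_eventually[OF tendsto_const]) (auto simp: eventually_at_filter flat_exp_def)
  ultimately show ?thesis using filterlim_split_at by blast
qed

text \<open>
  At the origin the difference quotient of \<open>flat_exp k\<close> is \<open>flat_exp (k + 1)\<close>, which tends to zero.
\<close>

lemma flat_exp_DERIV:
  "(flat_exp k has_real_derivative flat_exp (k + 2) x - of_nat k * flat_exp (k + 1) x) (at x)"
proof (cases x "0 :: real" rule: linorder_cases)
  case less
  have "((\<lambda>x. 0) has_real_derivative 0) (at x)" by simp
  then show ?thesis
    using less
    by (subst DERIV_cong_ev[where g = "\<lambda>x. 0" and v = 0])
       (auto simp: flat_exp_def intro!: eventually_mono[OF eventually_nhds_in_open[of "{..<0}"]])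
next
  case equal
  have "((\<lambda>h. (flat_exp k (0 + h) - flat_exp k 0) / h) \<longlongrightarrow> 0) (at 0)"
    by (rule Lim_transform_eventually[OF flat_exp_tendsto_0[of "Suc k"]])
       (auto simp: eventually_at_filter flat_exp_def)
  then show ?thesis using equal by (simp add: DERIV_def) (simp add: flat_exp_def)
next
  case greater
  have "((\<lambda>x. (1 / x) ^ k * exp (- (1 / x))) has_real_derivative
          (1 / x) ^ (k + 2) * exp (- (1 / x)) - of_nat k * ((1 / x) ^ (k
              + 1) * exp (- (1 / x)))) (at x)"
    using greater
    by (auto intro!: derivative_eq_intros simp: field_simps power2_eq_square)
       (cases k; auto simp: field_simps power_diff)
  then show ?thesis
    using greater
    by (subst DERIV_cong_ev[where g = "\<lambda>x. (1 / x) ^ k * exp (- (1 / x))"])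
       (auto simp: flat_exp_def intro!: eventually_mono[OF eventually_nhds_in_open[of "{0<..}"]])
qed

lemma times_diff_flat_exp: "times_diff n (flat_exp k)"
proof (induction n arbitrary: k)
  case (Suc n)
  have "times_diff n (\<lambda>x. flat_exp (k + 2) x + (- of_nat k) * flat_exp (k + 1) x)"
    by (intro times_diff_add times_diff_mult times_diff_const Suc.IH)
  then show ?case
    by (rule times_diff_SucI[rotated]) (use flat_exp_DERIV[of k] in simp)
qed simp

text \<open>
  The transition from 0 to 1 is confined to \<open>[1/3, 2/3]\<close>, a compact part of the interior of the unit
  interval. A transition that is rescaled to a gap is therefore constant near the end points of the gap.
\<close>

definition smooth_step :: "real \<Rightarrow> real" where
  "smooth_step u = flat_exp 0 (3 * u - 1) * inverse (flat_exp 0 (3 * u - 1) + flat_exp 0 (2 - 3 * u))"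

lemma flat_exp_0: "flat_exp 0 x \<ge> 0" "x > 0 \<Longrightarrow> flat_exp 0 x > 0" "x \<le> 0 \<Longrightarrow> flat_exp 0 x = 0"
  by (auto simp: flat_exp_def)

lemma smooth_step_denom_pos: "flat_exp 0 (3 * u - 1) + flat_exp 0 (2 - 3 * u) > 0"
  using flat_exp_0(1)[of "3 * u - 1"] flat_exp_0(1)[of "2 - 3 * u"]
        flat_exp_0(2)[of "3 * u - 1"] flat_exp_0(2)[of "2 - 3 * u"]
  by (cases "3 * u - 1 > 0") auto

lemma times_diff_smooth_step: "times_diff n smooth_step"
proof -
  have 1: "times_diff n (\<lambda>u. flat_exp 0 (3 * u + (-1)))"
    by (rule times_diff_affine[OF times_diff_flat_exp])
  have 2: "times_diff n (\<lambda>u. flat_exp 0 ((-3) * u + 2))"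
    by (rule times_diff_affine[OF times_diff_flat_exp])
  have "times_diff n (\<lambda>u. flat_exp 0 (3 * u + (-1)) *
          inverse (flat_exp 0 (3 * u + (-1)) + flat_exp 0 ((-3) * u + 2)))"
    using smooth_step_denom_pos
    by (intro times_diff_mult times_diff_inverse times_diff_add 1 2) (auto simp: less_imp_neq[symmetric])
  also have "(\<lambda>u. flat_exp 0 (3 * u + (-1)) *
          inverse (flat_exp 0 (3 * u + (-1)) + flat_exp 0 ((-3) * u + 2))) = smooth_step"
    by (auto simp: smooth_step_def)
  finally show ?thesis .
qed

lemma smooth_step_bounds: "0 \<le> smooth_step u" "smooth_step u \<le> 1"
  using smooth_step_denom_pos[of u] flat_exp_0(1)[of "3 * u - 1"] flat_exp_0(1)[of "2 - 3 * u"]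
  by (auto simp: smooth_step_def field_simps)

lemma smooth_step_eq_0: "u \<le> 1/3 \<Longrightarrow> smooth_step u = 0"
  by (auto simp: smooth_step_def flat_exp_0(3))

lemma smooth_step_eq_1: "u \<ge> 2/3 \<Longrightarrow> smooth_step u = 1"
  using smooth_step_denom_pos[of u] by (auto simp: smooth_step_def flat_exp_0(3))

lemma times_diff_higher_deriv:
  assumes "\<And>n. times_diff n f"
  shows "(deriv ^^ n) f differentiable at x"
proof -
  have "times_diff (Suc n) f \<Longrightarrow> (deriv ^^ n) f differentiable at x"
    by (induction n arbitrary: f) (auto simp: funpow_swap1)
  then show ?thesis using assms by blast
qed

lemma higher_deriv_smooth_step_DERIV:
  "((deriv ^^ n) smooth_step has_real_derivative (deriv ^^ Suc n) smooth_step x) (at x)"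
  using times_diff_higher_deriv[OF times_diff_smooth_step]
      by (simp add: DERIV_deriv_iff_real_differentiable)

lemma higher_deriv_const: "n > 0 \<Longrightarrow> (deriv ^^ n) (\<lambda>x::real. c::real) y = 0"
proof (induction n arbitrary: y)
  case (Suc n)
  have "(deriv ^^ n) (\<lambda>x. 0::real) = (\<lambda>x. 0)"
    by (induction n) simp_all
  then have "(deriv ^^ n) (deriv (\<lambda>x::real. c)) = (\<lambda>x. 0)" by simp
  then show ?case by (simp add: funpow_swap1)
qed simp

lemma higher_deriv_smooth_step_bounded: "\<exists>C\<ge>1. \<forall>u. \<bar>(deriv ^^ n) smooth_step u\<bar> \<le> C"
proof (cases "n = 0")
  case True
  then show ?thesis using smooth_step_bounds by (auto intro!: exI[of _ 1])
next
  case False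
  let ?f = "(deriv ^^ n) smooth_step"
  have "continuous_on {0..1} ?f"
    by (intro continuous_at_imp_continuous_on ballI DERIV_isCont[OF higher_deriv_smooth_step_DERIV])
  then have "bounded (?f ` {0..1})"
    by (intro compact_imp_bounded compact_continuous_image) auto
  then obtain C where "\<forall>u\<in>{0..1}. \<bar>?f u\<bar> \<le> C"
    by (auto simp: bounded_iff)
  then have C: "\<bar>?f u\<bar> \<le> C" if "u \<in> {0..1}" for u using that by blast
  have "?f u = 0" if "u < 0" for u
  proof -
    have "eventually (\<lambda>x. smooth_step x = 0) (nhds u)"
      using eventually_nhds_in_open[of "{..<0}" u] that
      by (auto elim!: eventually_mono intro: smooth_step_eq_0)
    from higher_deriv_cong_ev[OF this refl, of n] False show ?thesis by (simp add: higher_deriv_const)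
  qed
  moreover have "?f u = 0" if "u > 1" for u
  proof -
    have "eventually (\<lambda>x. smooth_step x = 1) (nhds u)"
      using eventually_nhds_in_open[of "{1<..}" u] that
      by (auto elim!: eventually_mono intro: smooth_step_eq_1)
    from higher_deriv_cong_ev[OF this refl, of n] False show ?thesis by (simp add: higher_deriv_const)
  qed
  ultimately have "\<bar>?f u\<bar> \<le> max C 1" for u
    using C[of u] by (cases "u < 0"; cases "u > 1") auto
  then show ?thesis by (intro exI[of _ "max C 1"]) auto
qed

text \<open>
  Near each point, a product of the smooth digit functions defined below is a multiple of one rescaled
  transition plus a constant. This form is preserved by affine substitutions, and \<open>\<Gamma>\<close> alone controls
  the growth of all its derivatives.
\<close>

definition local_step :: "real \<Rightarrow> (real \<Rightarrow> real) \<Rightarrow> real \<Rightarrow> bool" where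
  "local_step \<Gamma> f y \<longleftrightarrow> (\<exists>a b l c. \<bar>b\<bar> \<le> 2 \<and> \<bar>l\<bar> \<le> \<Gamma> \<and> (\<forall>\<^sub>F u in nhds y. f u = a
      + b * smooth_step (l * u + c)))"

lemma higher_deriv_affine_smooth_step:
  "(deriv ^^ Suc n) (\<lambda>u. a + b * smooth_step (l * u + c))
      = (\<lambda>u. b * l ^ Suc n * (deriv ^^ Suc n) smooth_step (l * u + c))"
proof (induction n)
  case 0
  have "((\<lambda>u. a + b * smooth_step (l * u + c)) has_real_derivative b * l * deriv smooth_step (l * u
      + c)) (at u)" for u
  proof -
    have "((\<lambda>u. smooth_step (l * u + c)) has_real_derivative deriv smooth_step (l * u + c) * l) (at u)"
      by (rule DERIV_chain2[OF higher_deriv_smooth_step_DERIV[of 0, simplified]]) (auto intro!: derivative_eq_intros)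
    from DERIV_add[OF DERIV_const[of a] DERIV_cmult[OF this, of b]] show ?thesis by (simp add: mult_ac)
  qed
  then show ?case by (auto intro: DERIV_imp_deriv)
next
  case (Suc n)
  have "((\<lambda>u. b * l ^ Suc n * (deriv ^^ Suc n) smooth_step (l * u + c)) has_real_derivative
     b * l ^ Suc (Suc n) * (deriv ^^ Suc (Suc n)) smooth_step (l * u + c)) (at u)" for u
  proof -
    have "((\<lambda>u. (deriv ^^ Suc n) smooth_step (l * u
        + c)) has_real_derivative (deriv ^^ Suc (Suc n)) smooth_step (l * u + c) * l) (at u)"
      by (rule DERIV_chain2[OF higher_deriv_smooth_step_DERIV]) (auto intro!: derivative_eq_intros)
    from DERIV_cmult[OF this, of "b * l ^ Suc n"] show ?thesis by (simp add: mult_ac)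
  qed
  then have "deriv (\<lambda>u. b * l ^ Suc n * (deriv ^^ Suc n) smooth_step (l * u + c)) =
     (\<lambda>u. b * l ^ Suc (Suc n) * (deriv ^^ Suc (Suc n)) smooth_step (l * u + c))"
    by (auto intro: DERIV_imp_deriv)
  then show ?case using Suc by simp
qed

lemma local_step_DERIV:
  assumes "local_step \<Gamma> f y"
  shows "((deriv ^^ n) f has_real_derivative (deriv ^^ Suc n) f y) (at y)"
proof -
  obtain a b l c where ev: "\<forall>\<^sub>F u in nhds y. f u = a + b * smooth_step (l * u + c)"
    using assms by (auto simp: local_step_def)
  let ?g = "\<lambda>u. a + b * smooth_step (l * u + c)"
  have "\<forall>\<^sub>F v in nhds y. \<forall>\<^sub>F u in nhds v. f u = ?g u" using ev by (simp add: eventually_eventually)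
  then have "\<forall>\<^sub>F u in nhds y. (deriv ^^ n) f u = (deriv ^^ n) ?g u"
    by eventually_elim (auto intro: higher_deriv_cong_ev)
  moreover have "((deriv ^^ n) ?g has_real_derivative (deriv ^^ Suc n) ?g y) (at y)"
  proof -
    have "times_diff k ?g" for k
      by (intro times_diff_add times_diff_mult times_diff_const times_diff_affine times_diff_smooth_step)
    from times_diff_higher_deriv[OF this, of n y] show ?thesis
      by (simp add: DERIV_deriv_iff_real_differentiable)
  qed
  moreover have "(deriv ^^ Suc n) f y = (deriv ^^ Suc n) ?g y"
    by (rule higher_deriv_cong_ev[OF ev refl])
  ultimately show ?thesis using DERIV_cong_ev[OF refl] by metis
qed

lemma local_step_higher_deriv_bound:
  assumes "\<bar>f y\<bar> \<le> 1" "local_step \<Gamma> f y" "\<And>u. \<bar>(deriv ^^ n) smooth_step u\<bar> \<le> C" "C \<ge> 1"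
  shows "\<bar>(deriv ^^ n) f y\<bar> \<le> 2 * C * \<Gamma> ^ n"
proof (cases n)
  case 0
  then show ?thesis using assms by auto
next
  case (Suc k)
  obtain a b l c where bl: "\<bar>b\<bar> \<le> 2" "\<bar>l\<bar> \<le> \<Gamma>" and ev:
      "\<forall>\<^sub>F u in nhds y. f u = a + b * smooth_step (l * u + c)"
    using assms by (auto simp: local_step_def)
  have "(deriv ^^ n) f y = b * l ^ n * (deriv ^^ n) smooth_step (l * y + c)"
    using higher_deriv_cong_ev[OF ev refl, of n] unfolding Suc higher_deriv_affine_smooth_step .
  also have "\<bar>\<dots>\<bar> = \<bar>b\<bar> * \<bar>l\<bar> ^ n * \<bar>(deriv ^^ n) smooth_step (l * y + c)\<bar>"
    by (simp add: abs_mult power_abs)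
  also have "\<dots> \<le> 2 * \<Gamma> ^ n * C"
    using bl assms(3) by (intro mult_mono power_mono) auto
  finally show ?thesis by (simp add: mult_ac)
qed

section \<open>Series over mirrored ternary digits\<close>

text \<open>
  The sequences of half-lengths of nested cells.
\<close>

definition shrinking :: "(nat \<Rightarrow> real) \<Rightarrow> bool" where
  "shrinking L \<longleftrightarrow> (\<forall>i. L (Suc i) < L i) \<and> L \<longlonglongrightarrow> 0"

lemma shrinking_pos: "shrinking L \<Longrightarrow> L i > 0"
proof -
  assume L: "shrinking L"
  then have dec: "decseq L" by (auto simp: shrinking_def decseq_Suc_iff intro: less_imp_le)
  have "0 \<le> L (Suc i)" using L dec by (intro decseq_ge) (auto simp: shrinking_def)
  also have "\<dots> < L i" using L by (simp add: shrinking_def)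
  finally show ?thesis .
qed

lemma shrinking_tail: "shrinking L \<Longrightarrow> shrinking (\<lambda>i. L (i + n))"
  by (auto simp: shrinking_def LIMSEQ_ignore_initial_segment)

lemma shrinking_Suc: "shrinking L \<Longrightarrow> shrinking (\<lambda>i. L (Suc i))"
  using shrinking_tail[of L 1] by simp

lemma shrinking_steps_sums: "shrinking L \<Longrightarrow> (\<lambda>i. L i - L (Suc i)) sums L 0"
  using telescope_sums'[of L 0] by (auto simp: shrinking_def)

text \<open>
  The value that a sequence of mirrored digits describes: \<open>E i\<close> selects a subcell of the cell of half-length
  \<open>L i\<close>, and \<open>B i\<close> is \<open>-1\<close> if the order inside that subcell is reversed, otherwise \<open>1\<close>. Values strictly between
  these occur at points in a gap. With \<open>L i = 3\<^sup>-\<^sup>i\<close> the series is a ternary expansion, and with the cell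
  lengths of a Cantor set it is a point of that set.
\<close>

definition signed_series :: "(nat \<Rightarrow> real) \<Rightarrow> (nat \<Rightarrow> real) \<Rightarrow> (nat \<Rightarrow> real) \<Rightarrow> real" where
  "signed_series L E B = (\<Sum>i. (\<Prod>k<i. B k) * E i * (L i - L (Suc i)))"

definition digits_ok :: "(nat \<Rightarrow> real) \<Rightarrow> (nat \<Rightarrow> real) \<Rightarrow> bool" where
  "digits_ok E B \<longleftrightarrow> (\<forall>i. \<bar>E i\<bar> \<le> 1 \<and> \<bar>B i\<bar> \<le> 1)"

lemma digits_okI: "(\<And>i. \<bar>E i\<bar> \<le> 1) \<Longrightarrow> (\<And>i. \<bar>B i\<bar> \<le> 1) \<Longrightarrow> digits_ok E B"
  by (simp add: digits_ok_def)

lemma digits_ok_tail: "digits_ok E B \<Longrightarrow> digits_ok (\<lambda>i. E (i + n)) (\<lambda>i. B (i + n))"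
  "digits_ok E B \<Longrightarrow> digits_ok (\<lambda>i. E (Suc i)) (\<lambda>i. B (Suc i))"
  by (auto simp: digits_ok_def)

lemma prod_abs_le_1: "(\<And>i. i \<in> A \<Longrightarrow> \<bar>f i :: real\<bar> \<le> 1) \<Longrightarrow> \<bar>prod f A\<bar> \<le> 1"
  unfolding abs_prod by (rule prod_le_1) auto

lemma signed_series_term_bound:
  assumes "shrinking L" "digits_ok E B"
  shows "\<bar>(\<Prod>k<i. B k) * E i * (L i - L (Suc i))\<bar> \<le> L i - L (Suc i)"
proof -
  have "L i - L (Suc i) \<ge> 0" using assms(1) by (simp add: shrinking_def less_imp_le)
  moreover have "\<bar>(\<Prod>k<i. B k)\<bar> * \<bar>E i\<bar> \<le> 1 * 1"
    using assms(2) by (intro mult_mono prod_abs_le_1) (auto simp: digits_ok_def)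
  ultimately have "(\<bar>\<Prod>k<i. B k\<bar> * \<bar>E i\<bar>) * (L i - L (Suc i)) \<le> 1 * (L i - L (Suc i))"
    by (intro mult_right_mono) simp_all
  then show ?thesis using \<open>L i - L (Suc i) \<ge> 0\<close> by (simp only: abs_mult abs_of_nonneg mult_1_left)
qed

lemma signed_series_summable:
  assumes "shrinking L" "digits_ok E B"
  shows "summable (\<lambda>i. (\<Prod>k<i. B k) * E i * (L i - L (Suc i)))"
proof (rule summable_comparison_test'[OF sums_summable[OF shrinking_steps_sums[OF assms(1)]]])
  show "norm ((\<Prod>k<i. B k) * E i * (L i - L (Suc i))) \<le> L i - L (Suc i)" for i
    using signed_series_term_bound[OF assms] by (simp only: real_norm_def)
qed

lemma signed_series_bound:
  assumes "shrinking L" "digits_ok E B"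
  shows "\<bar>signed_series L E B\<bar> \<le> L 0"
proof -
  have "norm (signed_series L E B) \<le> (\<Sum>i. L i - L (Suc i))"
    unfolding signed_series_def
    using signed_series_term_bound[OF assms]
    by (intro norm_suminf_le sums_summable[OF shrinking_steps_sums[OF assms(1)]]) (simp only: real_norm_def)
  also have "\<dots> = L 0" using sums_unique[OF shrinking_steps_sums[OF assms(1)]] by (rule sym)
  finally show ?thesis by (simp only: real_norm_def)
qed

lemma signed_series_rec:
  assumes "shrinking L" "digits_ok E B"
  shows "signed_series L E B = E 0 * (L 0 - L 1)
      + B 0 * signed_series (\<lambda>i. L (Suc i)) (\<lambda>i. E (Suc i)) (\<lambda>i. B (Suc i))"
proof -
  have "signed_series L E B = (\<Sum>i. (\<Prod>k<Suc i. B k) * E (Suc i) * (L (Suc i) - L (Suc (Suc i))))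
      + E 0 * (L 0 - L 1)"
    unfolding signed_series_def using suminf_split_head[OF signed_series_summable[OF assms]] by simp
  also have "(\<lambda>i. (\<Prod>k<Suc i. B k) * E (Suc i) * (L (Suc i) - L (Suc (Suc i))))
      = (\<lambda>i. B 0 * ((\<Prod>k<i. B (Suc k)) * E (Suc i) * (L (Suc i) - L (Suc (Suc i)))))"
    by (auto simp: prod.lessThan_Suc_shift mult_ac simp del: prod.lessThan_Suc)
  also have "suminf \<dots> = B 0 * signed_series (\<lambda>i. L (Suc i)) (\<lambda>i. E (Suc i)) (\<lambda>i. B (Suc i))"
    unfolding signed_series_def
    by (rule suminf_mult[OF signed_series_summable[OF shrinking_Suc[OF assms(1)] digits_ok_tail(2)[OF assms(2)]]])
  finally show ?thesis by (simp only: add.commute)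
qed

text \<open>
  A bounded solution of the tail recursion is determined by the digits, since the part that is still
  unknown after \<open>n\<close> steps is at most \<open>L n\<close>.
\<close>

lemma signed_series_unique:
  assumes "shrinking L" "digits_ok E B"
    and a: "\<And>i. a i = E i * (L i - L (Suc i)) + B i * a (Suc i)" "\<And>i. \<bar>a i\<bar> \<le> L i"
  shows "a 0 = signed_series L E B"
proof -
  let ?t = "\<lambda>i. (\<Prod>k<i. B k) * E i * (L i - L (Suc i))"
  have split: "a 0 = (\<Sum>i<n. ?t i) + (\<Prod>k<n. B k) * a n" for n
  proof (induction n)
    case (Suc n)
    have "(\<Prod>k<n. B k) * a n = ?t n + (\<Prod>k<Suc n. B k) * a (Suc n)"
      using arg_cong[OF a(1)[of n], of "\<lambda>z. (\<Prod>k<n. B k) * z"] by (simp add: distrib_left mult.assoc)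
    then show ?case using Suc by simp
  qed simp
  have "(\<lambda>n. (\<Prod>k<n. B k) * a n) \<longlonglongrightarrow> 0"
  proof (rule Lim_null_comparison)
    show "\<forall>\<^sub>F n in sequentially. norm ((\<Prod>k<n. B k) * a n) \<le> L n"
    proof (intro always_eventually allI)
      fix n
      have "\<bar>\<Prod>k<n. B k\<bar> * \<bar>a n\<bar> \<le> 1 * L n"
        using assms(2) a(2) by (intro mult_mono prod_abs_le_1) (auto simp: digits_ok_def)
      then show "norm ((\<Prod>k<n. B k) * a n) \<le> L n" by (simp add: abs_mult)
    qed
    show "L \<longlonglongrightarrow> 0" using assms(1) by (simp add: shrinking_def)
  qed
  then have "(\<lambda>n. a 0 - (\<Prod>k<n. B k) * a n) \<longlonglongrightarrow> a 0 - 0"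
    by (rule tendsto_diff[OF tendsto_const])
  also have "(\<lambda>n. a 0 - (\<Prod>k<n. B k) * a n) = (\<lambda>n. \<Sum>i<n. ?t i)"
  proof
    fix n show "a 0 - (\<Prod>k<n. B k) * a n = (\<Sum>i<n. ?t i)" using split[of n] by linarith
  qed
  finally have "?t sums a 0" by (simp add: sums_def)
  then show ?thesis unfolding signed_series_def by (rule sums_unique)
qed

lemma signed_series_const: "shrinking L \<Longrightarrow> signed_series L (\<lambda>i. c) (\<lambda>i. 1) = c * L 0"
  using shrinking_steps_sums[of L] sums_mult[of "\<lambda>i. L i - L (Suc i)" "L 0" c]
  by (auto simp: signed_series_def sums_iff)

text \<open>
  The digits after place \<open>n\<close> are constantly \<open>c\<close> and add up to \<open>c * L (Suc n)\<close>. So the entry at place \<open>n\<close>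
  matters only through the combination in the last assumption. Neighbouring digits give the same
  combination when \<open>c\<close> is the digit of the common end, and this is what keeps the map constant across a gap.
\<close>

lemma signed_series_switch:
  assumes "shrinking L" "digits_ok E B" "digits_ok E' B'"
    and "\<And>i. i \<noteq> n \<Longrightarrow> E i = E' i \<and> B i = B' i"
    and "\<And>i. i > n \<Longrightarrow> E i = c \<and> B i = 1"
    and "E n * (L n - L (Suc n)) + B n * c * L (Suc n) = E' n * (L n - L (Suc n))
        + B' n * c * L (Suc n)"
  shows "signed_series L E B = signed_series L E' B'"
  using assms
proof (induction n arbitrary: L E B E' B')
  case 0
  let ?T = "signed_series (\<lambda>i. L (Suc i)) (\<lambda>i. E (Suc i)) (\<lambda>i. B (Suc i))"
  let ?T' = "signed_series (\<lambda>i. L (Suc i)) (\<lambda>i. E' (Suc i)) (\<lambda>i. B' (Suc i))"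
  have T: "?T = c * L 1"
  proof -
    have "(\<lambda>i. E (Suc i)) = (\<lambda>i. c)" "(\<lambda>i. B (Suc i)) = (\<lambda>i. 1)" using "0.prems"(5) by auto
    then show ?thesis using signed_series_const[OF shrinking_Suc[OF "0.prems"(1)], of c] by simp
  qed
  have "(\<lambda>i. E (Suc i)) = (\<lambda>i. E' (Suc i))" "(\<lambda>i. B (Suc i)) = (\<lambda>i. B' (Suc i))"
    using "0.prems"(4) by auto
  then have T': "?T' = c * L 1" using T by simp
  show ?case
    unfolding signed_series_rec[OF "0.prems"(1,2)] signed_series_rec[OF "0.prems"(1,3)] T T'
    using "0.prems"(6) by simp
next
  case (Suc n)
  have "signed_series (\<lambda>i. L (Suc i)) (\<lambda>i. E (Suc i)) (\<lambda>i. B (Suc i))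
      = signed_series (\<lambda>i. L (Suc i)) (\<lambda>i. E' (Suc i)) (\<lambda>i. B' (Suc i))"
  proof (rule Suc.IH[OF shrinking_Suc[OF Suc.prems(1)] digits_ok_tail(2)[OF Suc.prems(2)] digits_ok_tail(2)[OF Suc.prems(3)]])
    show "E (Suc i) = E' (Suc i) \<and> B (Suc i) = B' (Suc i)" if "i \<noteq> n" for i
      using that by (intro Suc.prems(4)) simp
    show "E (Suc i) = c \<and> B (Suc i) = 1" if "i > n" for i
      using that by (intro Suc.prems(5)) simp
  qed (rule Suc.prems(6))
  moreover have "E 0 = E' 0 \<and> B 0 = B' 0" by (rule Suc.prems(4)) simp
  ultimately show ?case
    unfolding signed_series_rec[OF Suc.prems(1,2)] signed_series_rec[OF Suc.prems(1,3)] by simp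
qed

text \<open>
  The middle subcell is the reflected one. With an odd number of subcells the tail digit next to a common
  end depends only on the two digits that meet there, so that one tail serves the source and the target.
\<close>

definition orientation :: "real \<Rightarrow> real" where "orientation e = 2 * \<bar>e\<bar> - 1"

definition trit :: "real \<Rightarrow> bool" where "trit e \<longleftrightarrow> e = -1 \<or> e = 0 \<or> e = 1"

abbreviation mirrored_value :: "(nat \<Rightarrow> real) \<Rightarrow> (nat \<Rightarrow> real) \<Rightarrow> real" where
  "mirrored_value L e \<equiv> signed_series L e (\<lambda>i. orientation (e i))"

lemma trit_digits_ok: "(\<And>i. trit (e i)) \<Longrightarrow> digits_ok e (\<lambda>i. orientation (e i))"
proof (rule digits_okI)
  fix i assume *: "\<And>i. trit (e i)"
  show "\<bar>e i\<bar> \<le> 1" "\<bar>orientation (e i)\<bar> \<le> 1" using *[of i] by (auto simp: trit_def orientation_def)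
qed

text \<open>
  Only the outer subcell on the side of \<open>c\<close> reaches the end \<open>c * L 0\<close> of the cell, and it does so
  at its own end on that side.
\<close>

lemma mirrored_value_extreme:
  assumes "shrinking L" "\<And>i. trit (e i)" "\<bar>c\<bar> = 1" "mirrored_value L e = c * L 0"
  shows "e i = c"
  using assms
proof (induction i arbitrary: L e)
  case 0
  let ?T = "mirrored_value (\<lambda>i. L (Suc i)) (\<lambda>i. e (Suc i))"
  have "\<bar>?T\<bar> \<le> L (Suc 0)"
    by (rule signed_series_bound) (use 0 in \<open>auto intro: shrinking_Suc trit_digits_ok\<close>)
  moreover have "e 0 * (L 0 - L 1) + orientation (e 0) * ?T = c * L 0"
    using signed_series_rec[OF 0(1) trit_digits_ok[of e]] 0 by simp
  moreover have "L 1 < L 0" "0 < L 1" using 0(1) shrinking_pos[of L 1] by (auto simp: shrinking_def)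
  moreover have "trit (e 0)" "c = 1 \<or> c = -1" using 0 by auto
  ultimately show ?case unfolding trit_def orientation_def by auto
next
  case (Suc i)
  let ?T = "mirrored_value (\<lambda>i. L (Suc i)) (\<lambda>i. e (Suc i))"
  have "\<bar>?T\<bar> \<le> L (Suc 0)"
    by (rule signed_series_bound) (use Suc in \<open>auto intro: shrinking_Suc trit_digits_ok\<close>)
  moreover have "e 0 * (L 0 - L 1) + orientation (e 0) * ?T = c * L 0"
    using signed_series_rec[OF Suc(2) trit_digits_ok[of e]] Suc by simp
  moreover have "L 1 < L 0" "0 < L 1" using Suc(2) shrinking_pos[of L 1] by (auto simp: shrinking_def)
  moreover have "trit (e 0)" "c = 1 \<or> c = -1" using Suc by auto
  ultimately have "?T = c * L (Suc 0)" unfolding trit_def orientation_def by auto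
  then show ?case
    using Suc.prems by (intro Suc.IH[of "\<lambda>i. L (Suc i)" "\<lambda>i. e (Suc i)"] shrinking_Suc) auto
qed

text \<open>
  A common prefix acts by an invertible affine map, because an orientation is never zero.
\<close>

lemma mirrored_value_cancel_prefix:
  assumes "shrinking L" "\<And>i. trit (e i)" "\<And>i. trit (e' i)" "\<And>i. i < n \<Longrightarrow> e i = e' i"
      "mirrored_value L e = mirrored_value L e'"
  shows "mirrored_value (\<lambda>i. L (i + n)) (\<lambda>i. e (i + n)) = mirrored_value (\<lambda>i. L (i + n)) (\<lambda>i. e' (i
      + n))"
  using assms
proof (induction n arbitrary: L e e')
  case (Suc n)
  have "e 0 = e' 0" by (rule Suc.prems) simp
  moreover have "orientation (e 0) \<noteq> 0" using Suc.prems(2)[of 0]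
      by (auto simp: trit_def orientation_def)
  ultimately have "mirrored_value (\<lambda>i. L (Suc i)) (\<lambda>i. e (Suc i))
      = mirrored_value (\<lambda>i. L (Suc i)) (\<lambda>i. e' (Suc i))"
    using signed_series_rec[OF Suc.prems(1) trit_digits_ok[OF Suc.prems(2)]]
      signed_series_rec[OF Suc.prems(1) trit_digits_ok[OF Suc.prems(3)]] Suc.prems(5) by auto
  from Suc.IH[OF shrinking_Suc[OF Suc.prems(1)] _ _ _ this] Suc.prems
  show ?case by simp
qed simp

definition triadic_len :: "nat \<Rightarrow> real" where "triadic_len i = (1/3) ^ i"

lemma shrinking_triadic_len: "shrinking triadic_len"
  by (auto simp: shrinking_def triadic_len_def[abs_def] intro!: LIMSEQ_power_zero)

text \<open>
  Intervals of half-length \<open>l\<close> about \<open>-2 l\<close>, \<open>0\<close> and \<open>2 l\<close> meet only in the end points of neighbours,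
  and the mirrored order names such a common end point by the same \<open>c\<close> from both sides.
\<close>

lemma trit_clash:
  assumes "trit a" "trit b" "a \<noteq> b" and t: "\<bar>t\<bar> \<le> l" "\<bar>t'\<bar> \<le> l" "l > 0"
    and eq: "a * (2 * l) + orientation a * t = b * (2 * l) + orientation b * t'"
  shows "\<exists>c. \<bar>c\<bar> = 1 \<and> {a, b} = {0, -c} \<and> t = c * l \<and> t' = c * l"
proof -
  consider "a = -1" "b = 0" | "a = 0" "b = -1" | "a = 0" "b = 1" | "a = 1" "b = 0" | "a = 1"
      "b = -1" | "a = -1" "b = 1"
    using assms(1-3) unfolding trit_def by blast
  then show ?thesis
  proof cases
    case 1
    with eq have "-2 * l + t = -t'" by (simp add: orientation_def)
    then have "t = l" "t' = l" using t by linarith+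
    then show ?thesis using 1 by (intro exI[of _ 1]) auto
  next
    case 2
    with eq have "-2 * l + t' = -t" by (simp add: orientation_def)
    then have "t = l" "t' = l" using t by linarith+
    then show ?thesis using 2 by (intro exI[of _ 1]) auto
  next
    case 3
    with eq have "2 * l + t' = -t" by (simp add: orientation_def)
    then have "t = -l" "t' = -l" using t by linarith+
    then show ?thesis using 3 by (intro exI[of _ "-1"]) auto
  next
    case 4
    with eq have "2 * l + t = -t'" by (simp add: orientation_def)
    then have "t = -l" "t' = -l" using t by linarith+
    then show ?thesis using 4 by (intro exI[of _ "-1"]) auto
  next
    case 5
    with eq have "2 * l + t = -2 * l + t'" by (simp add: orientation_def)
    then show ?thesis using t by linarith
  next
    case 6
    with eq have "-2 * l + t = 2 * l + t'" by (simp add: orientation_def)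
    then show ?thesis using t by linarith
  qed
qed

lemma mirrored_value_triadic_len_ambiguous:
  assumes e: "\<And>i. trit (e i)" and e': "\<And>i. trit (e' i)" and eq:
      "mirrored_value triadic_len e = mirrored_value triadic_len e'" and ne: "e \<noteq> e'"
  obtains n c where "\<bar>c\<bar> = 1" "\<And>i. i < n \<Longrightarrow> e i = e' i" "{e n, e' n} = {0, - c}" "\<And>i. i > n
      \<Longrightarrow> e i = c \<and> e' i = c"
proof -
  define n where "n = (LEAST n. e n \<noteq> e' n)"
  have "\<exists>n. e n \<noteq> e' n" using ne by auto
  then have n: "e n \<noteq> e' n" unfolding n_def by (rule LeastI_ex)
  have agree: "i < n \<Longrightarrow> e i = e' i" for i unfolding n_def using not_less_Least by blast
  let ?L = "\<lambda>i. triadic_len (Suc i + n)"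
  let ?T = "mirrored_value ?L (\<lambda>i. e (Suc i + n))" and ?T' = "mirrored_value ?L (\<lambda>i. e' (Suc i + n))"
  have sL: "shrinking ?L" by (rule shrinking_Suc[OF shrinking_tail[OF shrinking_triadic_len]])
  have T: "\<bar>?T\<bar> \<le> ?L 0" "\<bar>?T'\<bar> \<le> ?L 0"
    by (rule signed_series_bound[OF sL trit_digits_ok]; use e e' in simp)+
  have "mirrored_value (\<lambda>i. triadic_len (i + n)) (\<lambda>i. e (i + n))
      = mirrored_value (\<lambda>i. triadic_len (i + n)) (\<lambda>i. e' (i + n))"
    by (rule mirrored_value_cancel_prefix[OF shrinking_triadic_len e e' agree eq])
  then have eq': "e n * (2 * ?L 0) + orientation (e n) * ?T = e' n * (2 * ?L 0)
      + orientation (e' n) * ?T'"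
  proof -
    have step: "triadic_len n - triadic_len (1 + n) = 2 * triadic_len (Suc 0 + n)"
        by (simp add: triadic_len_def)
    have "mirrored_value (\<lambda>i. triadic_len (i + n)) (\<lambda>i. f (i + n)) =
        f n * (2 * ?L 0) + orientation (f n) * mirrored_value ?L (\<lambda>i. f (Suc i + n))" if
            "\<And>i. trit (f i)" for f
      using signed_series_rec[OF shrinking_tail[OF shrinking_triadic_len, of n] trit_digits_ok[of
          "\<lambda>i. f (i + n)"]] that
      unfolding add_0 step by blast
    from this[of e] this[of e'] e e' show ?thesis
      using \<open>mirrored_value (\<lambda>i. triadic_len (i + n)) (\<lambda>i. e (i + n))
          = mirrored_value (\<lambda>i. triadic_len (i + n)) (\<lambda>i. e' (i + n))\<close> by metis
  qed
  have pos: "?L 0 > 0" using shrinking_pos[OF sL] .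
  have "\<exists>c. \<bar>c\<bar> = 1 \<and> {e n, e' n} = {0, -c} \<and> ?T = c * ?L 0 \<and> ?T' = c * ?L 0"
    by (rule trit_clash[OF e e' n T pos eq'])
  then obtain c where c: "\<bar>c\<bar> = 1" "{e n, e' n} = {0, -c}" "?T = c * ?L 0" "?T' = c * ?L 0" by blast
  have "e (Suc i + n) = c" "e' (Suc i + n) = c" for i
    using mirrored_value_extreme[OF sL _ c(1,3)] mirrored_value_extreme[OF sL _ c(1,4)] e e' by auto
  then have "e i = c \<and> e' i = c" if "i > n" for i
    using that by (metis add.commute add_Suc_right add_Suc less_imp_Suc_add)
  with c agree show ?thesis using that by blast
qed

text \<open>
  The greedy algorithm: choose a third that contains the number, then rescale and reflect that third.
\<close>

lemma trit_expansion:
  assumes "\<bar>v\<bar> \<le> 1"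
  shows "\<exists>e. (\<forall>i. trit (e i)) \<and> mirrored_value triadic_len e = v"
proof -
  define dg :: "real \<Rightarrow> real" where "dg = (\<lambda>v. if v > 1/3 then 1 else if v < -1/3 then -1 else 0)"
  define w where "w = rec_nat v (\<lambda>_ v. orientation (dg v) * (3 * v - 2 * dg v))"
  have w: "w 0 = v" "w (Suc i) = orientation (dg (w i)) * (3 * w i - 2 * dg (w i))" for i
      by (simp_all add: w_def)
  have bd: "\<bar>w i\<bar> \<le> 1" for i
    by (induction i) (use assms in \<open>auto simp: w dg_def orientation_def\<close>)
  have "w 0 * triadic_len 0 = mirrored_value triadic_len (\<lambda>i. dg (w i))"
  proof (rule signed_series_unique[OF shrinking_triadic_len trit_digits_ok])
    show "w i * triadic_len i = dg (w i) * (triadic_len i - triadic_len (Suc i))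
        + orientation (dg (w i)) * (w (Suc i) * triadic_len (Suc i))" for i
      by (auto simp: w dg_def orientation_def triadic_len_def field_simps)
    show "\<bar>w i * triadic_len i\<bar> \<le> triadic_len i" for i
      using bd[of i] by (auto simp: triadic_len_def abs_mult mult_left_le_one_le)
  qed (auto simp: trit_def dg_def)
  then show ?thesis by (intro exI[of _ "\<lambda>i. dg (w i)"]) (auto simp: w triadic_len_def trit_def dg_def)
qed

section \<open>A Cantor set with subexponentially small gaps\<close>

text \<open>
  The factor \<open>1 + 1 / (s + 1)\<close> makes a cell slightly longer than three of its subcells. The gaps are
  shorter than the cells by a polynomial factor in \<open>s\<close> only. A constant ratio of lengths would allow
  only the exponents below some bound smaller than \<open>M / d\<close>.
\<close>

definition cell_len :: "nat \<Rightarrow> real" where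
  "cell_len s = (1/3) ^ s * (1 + 1 / (real s + 1))"

definition gap_width :: "nat \<Rightarrow> real" where
  "gap_width s = cell_len s - 3 * cell_len (Suc s)"

lemma gap_width_eq: "gap_width s = (1/3) ^ s / ((real s + 1) * (real s + 2))"
proof -
  have "gap_width s = (1/3) ^ s * (1 / (real s + 1) - 1 / (real s + 2))"
    by (simp add: gap_width_def cell_len_def algebra_simps)
  also have "1 / (real s + 1) - 1 / (real s + 2) = 1 / ((real s + 1) * (real s + 2))"
    by (simp add: divide_simps)
  finally show ?thesis by simp
qed

lemma gap_width_pos: "gap_width s > 0" by (simp add: gap_width_eq)

lemma cell_len_pos: "cell_len s > 0" by (simp add: cell_len_def add_pos_pos)

lemma cell_len_Suc: "3 * cell_len (Suc s) < cell_len s" using gap_width_pos[of s]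
    by (simp add: gap_width_def)

lemma shrinking_cell_len: "shrinking cell_len"
proof -
  have "cell_len (Suc s) < cell_len s" for s using cell_len_Suc[of s] cell_len_pos[of "Suc s"]
      by linarith
  moreover have "cell_len \<longlonglongrightarrow> 0" unfolding cell_len_def[abs_def] by real_asymp
  ultimately show ?thesis by (simp add: shrinking_def)
qed

lemma cell_len_Suc_half: "cell_len (Suc s) \<le> (cell_len s - cell_len (Suc s)) / 2"
  using cell_len_Suc[of s] by simp

lemma cell_len_outer_half: "(cell_len s - cell_len (Suc s)) / 2 \<le> cell_len s - 2 * cell_len (Suc s)"
  using cell_len_Suc[of s] by (simp add: field_simps)

text \<open>
  The folding of a cell, centred at 0, that carries each of its three subcells onto the centred subcell and
  reverses the middle one. It is a zigzag of slopes \<open>1, -1, 1\<close> with its two corners at the centres of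
  the gaps, so the local coordinates of all levels have slope \<open>1\<close> or \<open>-1\<close> away from these corners.
\<close>

definition cell_fold :: "nat \<Rightarrow> real \<Rightarrow> real" where
  "cell_fold s y = y + \<bar>y - (cell_len s - cell_len (Suc s)) / 2\<bar> - \<bar>y
      + (cell_len s - cell_len (Suc s)) / 2\<bar>"

lemma cell_fold_eq:
  "y \<ge> (cell_len s - cell_len (Suc s)) / 2 \<Longrightarrow> cell_fold s y = y - (cell_len s - cell_len (Suc s))"
  "- y \<ge> (cell_len s - cell_len (Suc s)) / 2 \<Longrightarrow> cell_fold s y = y + (cell_len s - cell_len (Suc s))"
  "\<bar>y\<bar> \<le> (cell_len s - cell_len (Suc s)) / 2 \<Longrightarrow> cell_fold s y = - y"
  using cell_len_Suc[of s] cell_len_pos[of "Suc s"] unfolding cell_fold_def by argo+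

primrec local_coord :: "nat \<Rightarrow> real \<Rightarrow> real" where
  "local_coord 0 y = y"
| "local_coord (Suc s) y = cell_fold s (local_coord s y)"

definition in_gap :: "nat \<Rightarrow> real \<Rightarrow> bool" where
  "in_gap s y \<longleftrightarrow> cell_len (Suc s) < \<bar>y\<bar> \<and> \<bar>y\<bar> < cell_len s - 2 * cell_len (Suc s)"

lemma isCont_cell_fold: "isCont (cell_fold s) y" unfolding cell_fold_def by (intro continuous_intros)

lemma isCont_local_coord: "isCont (local_coord s) y"
proof (induction s)
  case 0
  have "local_coord 0 = (\<lambda>y. y)" by (auto simp: fun_eq_iff)
  then show ?case by simp
next
  case (Suc s)
  have "local_coord (Suc s) = (\<lambda>y. cell_fold s (local_coord s y))" by (auto simp: fun_eq_iff)
  moreover have "isCont (\<lambda>y. cell_fold s (local_coord s y)) y"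
    using continuous_within_compose2[of y UNIV "local_coord s" "cell_fold s"] Suc isCont_cell_fold
    by (metis continuous_at_imp_continuous_at_within isCont_o2)
  ultimately show ?case by simp
qed

text \<open>
  The folding sends both ends of a gap to the same end \<open>c\<close> of the subcell, and the gap itself beyond it.
\<close>

lemma cell_fold_gap:
  assumes "\<bar>c\<bar> = 1" "cell_len (Suc s) < - c * y" "- c * y < cell_len s - 2 * cell_len (Suc s)"
  shows "c * cell_fold s y > cell_len (Suc s)"
proof -
  have "c = 1 \<or> c = -1" using assms(1) by auto
  then show ?thesis
    using assms(2,3) cell_len_Suc[of s] cell_len_pos[of "Suc s"] unfolding cell_fold_def
        by (elim disjE; hypsubst; argo)
qed

lemma cell_fold_outside:
  assumes "\<bar>c\<bar> = 1" "c * y > cell_len s"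
  shows "c * cell_fold s y > cell_len (Suc s)"
proof -
  have "c = 1 \<or> c = -1" using assms(1) by auto
  then show ?thesis
    using assms(2) cell_len_Suc[of s] cell_len_pos[of "Suc s"] unfolding cell_fold_def
        by (elim disjE; hypsubst; argo)
qed

lemma local_coord_outside: 
  assumes "\<bar>c\<bar> = 1" "c * local_coord s y > cell_len s" "t \<ge> s"
  shows "c * local_coord t y > cell_len t"
  using assms(3) by (induction rule: dec_induct) (use assms cell_fold_outside in auto)

lemma local_coord_past_gap:
  assumes "\<bar>c\<bar> = 1" "cell_len (Suc s) < - c * local_coord s y"
      "- c * local_coord s y < cell_len s - 2 * cell_len (Suc s)" "t > s"
  shows "c * local_coord t y > cell_len t"
  using local_coord_outside[OF assms(1), of "Suc s" y t] cell_fold_gap[OF assms(1-3)] assms(4) by simp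

lemma in_gapE:
  assumes "in_gap s y"
  obtains c where "\<bar>c\<bar> = 1" "cell_len (Suc s) < - c * y" "- c * y < cell_len s - 2 * cell_len (Suc s)"
  using that[of 1] that[of "-1"] assms by (auto simp: in_gap_def abs_if split: if_splits)

text \<open>
  After a gap the local coordinate stays outside all later cells, so no later level sees a gap again.
\<close>

lemma in_gap_unique:
  assumes "in_gap s (local_coord s y)" "in_gap t (local_coord t y)"
  shows "s = t"
proof -
  have False if "in_gap s (local_coord s y)" "in_gap t (local_coord t y)" "s < t" for s t
  proof -
    obtain c where c: "\<bar>c\<bar> = 1" "cell_len (Suc s) < - c * local_coord s y"
        "- c * local_coord s y < cell_len s - 2 * cell_len (Suc s)"
      using \<open>in_gap s (local_coord s y)\<close> by (rule in_gapE)
    have "c * local_coord t y > cell_len t" by (rule local_coord_past_gap[OF c \<open>s < t\<close>])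
    moreover have "c * local_coord t y \<le> \<bar>local_coord t y\<bar>" using c(1)
        by (metis abs_ge_self abs_mult mult_1)
    ultimately show False using that(2) cell_len_pos[of "Suc t"] by (simp add: in_gap_def)
  qed
  then show ?thesis using assms by (metis linorder_neqE_nat)
qed

text \<open>
  The corners of the foldings lie in gaps.
\<close>

lemma local_coord_local_affine:
  assumes "\<And>t. t < s \<Longrightarrow> \<not> in_gap t (local_coord t y)"
  obtains e c where "\<bar>e\<bar> = 1" "\<forall>\<^sub>F u in nhds y. local_coord s u = e * u + c"
proof -
  have "\<exists>e c. \<bar>e\<bar> = 1 \<and> (\<forall>\<^sub>F u in nhds y. local_coord s u = e * u + c)"
    using assms
  proof (induction s)
    case 0
    show ?case by (rule exI[of _ 1], rule exI[of _ 0]) simp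
  next
    case (Suc s)
    then obtain e c where e: "\<bar>e\<bar> = 1" and ev: "\<forall>\<^sub>F u in nhds y. local_coord s u = e * u + c"
        by (metis less_SucI)
    define h where "h = (cell_len s - cell_len (Suc s)) / 2"
    have "\<not> in_gap s (local_coord s y)" using Suc.prems by simp
    then have "local_coord s y < - h \<or> \<bar>local_coord s y\<bar> < h \<or> local_coord s y > h"
      using cell_len_Suc[of s] cell_len_pos[of "Suc s"] unfolding in_gap_def h_def by argo
    then obtain e' c' S where S: "open S" "local_coord s y \<in> S" "\<bar>e'\<bar> = 1" "\<And>z. z \<in> S
        \<Longrightarrow> cell_fold s z = e' * z + c'"
    proof (elim disjE)
      assume "local_coord s y < -h"
      then show ?thesis using that[of "{..<-h}" 1
          "cell_len s - cell_len (Suc s)"] cell_fold_eq(2)[where s = s] unfolding h_def[symmetric]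
          by auto
    next
      assume "\<bar>local_coord s y\<bar> < h"
      show ?thesis
      proof (rule that[of "{-h<..<h}" "-1" 0])
        show "local_coord s y \<in> {-h<..<h}" using \<open>\<bar>local_coord s y\<bar> < h\<close> by auto
        show "cell_fold s z = -1 * z + 0" if "z \<in> {-h<..<h}" for z
        proof -
          have "\<bar>z\<bar> \<le> h" using that by auto
          then show ?thesis using cell_fold_eq(3)[of z s] by (simp only: h_def)
        qed
      qed auto
    next
      assume "local_coord s y > h"
      then show ?thesis using that[of "{h<..}" 1
          "- (cell_len s - cell_len (Suc s))"] cell_fold_eq(1)[where s = s] by (auto simp: h_def)
    qed
    have "\<forall>\<^sub>F u in nhds y. local_coord s u \<in> S"
      using isCont_local_coord[of y s] S(1,2)
          by (simp add: eventually_nhds_conv_at isCont_def topological_tendstoD)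
    with ev have "\<forall>\<^sub>F u in nhds y. local_coord (Suc s) u = (e' * e) * u + (e' * c + c')"
      by eventually_elim (auto simp: S(4) algebra_simps)
    moreover have "\<bar>e' * e\<bar> = 1" using e S(3) by (simp add: abs_mult)
    ultimately show ?case by blast
  qed
  then show ?thesis using that by blast
qed

definition gap_step :: "nat \<Rightarrow> real \<Rightarrow> real" where
  "gap_step s y = smooth_step ((y - cell_len (Suc s)) / gap_width s)"

text \<open>
  Smooth versions of the digit and of its orientation. The orientation is the function \<open>orientation\<close> of
  the digit also for the intermediate values in the gaps. Therefore \<open>2 * digit_fun + c * sign_fun\<close> equals
  \<open>- c\<close> throughout the gap on the side of \<open>- c\<close>.
\<close>

definition digit_fun :: "nat \<Rightarrow> real \<Rightarrow> real" where "digit_fun s y = gap_step s y - gap_step s (- y)"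
definition sign_fun :: "nat \<Rightarrow> real \<Rightarrow> real" where
    "sign_fun s y = 2 * (gap_step s y + gap_step s (- y)) - 1"

lemma gap_step_bounds: "0 \<le> gap_step s y" "gap_step s y \<le> 1"
    by (simp_all add: gap_step_def smooth_step_bounds)

lemma gap_step_0: "y \<le> cell_len (Suc s) + gap_width s / 3 \<Longrightarrow> gap_step s y = 0"
  unfolding gap_step_def using gap_width_pos[of s] by (intro smooth_step_eq_0) (simp add: field_simps)

lemma gap_step_1: "y \<ge> cell_len (Suc s) + 2 * gap_width s / 3 \<Longrightarrow> gap_step s y = 1"
  unfolding gap_step_def using gap_width_pos[of s] by (intro smooth_step_eq_1) (simp add: field_simps)

lemma gap_step_neg_0: "y \<le> 0 \<Longrightarrow> gap_step s y = 0"
  using cell_len_pos[of "Suc s"] gap_width_pos[of s] by (intro gap_step_0) simp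

lemma digit_sign_bounds: "\<bar>digit_fun s y\<bar> \<le> 1" "\<bar>sign_fun s y\<bar> \<le> 1"
proof -
  have "gap_step s y = 0 \<or> gap_step s (- y) = 0" by (cases "y \<le> 0") (auto simp: gap_step_neg_0)
  then show "\<bar>digit_fun s y\<bar> \<le> 1" "\<bar>sign_fun s y\<bar> \<le> 1"
    using gap_step_bounds[of s y] gap_step_bounds[of s "- y"]
        by (auto simp: digit_fun_def sign_fun_def abs_if)
qed

lemma digit_sign_middle: "\<bar>y\<bar> \<le> cell_len (Suc s) + gap_width s / 3
    \<Longrightarrow> digit_fun s y = 0 \<and> sign_fun s y = -1"
  using gap_step_0[of y s] gap_step_0[of "- y" s] by (auto simp: digit_fun_def sign_fun_def)

lemma digit_sign_outer:
  assumes "\<bar>c\<bar> = 1" "c * y \<ge> cell_len (Suc s) + 2 * gap_width s / 3"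
  shows "digit_fun s y = c \<and> sign_fun s y = 1"
proof -
  have pos: "c * y > 0" using assms(2) gap_width_pos[of s] cell_len_pos[of "Suc s"] by linarith
  have "c = 1 \<or> c = -1" using assms(1) by auto
  then show ?thesis using gap_step_1[OF assms(2)] pos gap_step_neg_0[of "- \<bar>y\<bar>" s]
    by (auto simp: digit_fun_def sign_fun_def)
qed

lemma digit_sign_side:
  assumes "\<bar>c\<bar> = 1" "c * y \<ge> 0"
  shows "digit_fun s y = c * gap_step s (c * y)" "sign_fun s y = 2 * gap_step s (c * y) - 1"
proof -
  have "c = 1 \<or> c = -1" using assms(1) by auto
  then show "digit_fun s y = c * gap_step s (c * y)" "sign_fun s y = 2 * gap_step s (c * y) - 1"
    using assms(2) gap_step_neg_0[of "- \<bar>y\<bar>" s] by (auto simp: digit_fun_def sign_fun_def)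
qed

lemma outer_width: "cell_len s - 2 * cell_len (Suc s) = cell_len (Suc s) + gap_width s"
    by (simp add: gap_width_def)

lemma digit_sign_far:
  assumes "\<bar>c\<bar> = 1" "c * y \<ge> cell_len s - 2 * cell_len (Suc s)"
  shows "digit_fun s y = c \<and> sign_fun s y = 1"
  using assms outer_width[of s] gap_width_pos[of s] by (intro digit_sign_outer) auto

lemma digit_sign_locally_const:
  assumes "\<not> in_gap s y"
  shows "\<forall>\<^sub>F u in nhds y. digit_fun s u = digit_fun s y \<and> sign_fun s u = sign_fun s y"
proof -
  have *: ?thesis if S: "open S" "y \<in> S" and const: "\<And>u. u \<in> S
      \<Longrightarrow> digit_fun s u = a \<and> sign_fun s u = b" for S a b
    using eventually_nhds_in_open[OF S] by (rule eventually_mono) (use const[OF S(2)] const in simp)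
  note g = gap_width_pos[of s] outer_width[of s]
  consider "\<bar>y\<bar> \<le> cell_len (Suc s)" | "y \<ge> cell_len s - 2 * cell_len (Suc s)" |
      "- y \<ge> cell_len s - 2 * cell_len (Suc s)"
    using assms unfolding in_gap_def by argo
  then show ?thesis
  proof cases
    case 1
    show ?thesis
    proof (rule *)
      show "open {u. \<bar>u\<bar> < cell_len (Suc s) + gap_width s / 3}"
        by (intro open_Collect_less continuous_intros)
      show "y \<in> {u. \<bar>u\<bar> < cell_len (Suc s) + gap_width s / 3}" using 1 g by simp
      show "digit_fun s u = 0 \<and> sign_fun s u = -1" if
          "u \<in> {u. \<bar>u\<bar> < cell_len (Suc s) + gap_width s / 3}" for u
        using that by (intro digit_sign_middle) simp
    qed
  next
    case 2
    show ?thesis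
    proof (rule *)
      show "open {u. cell_len (Suc s) + 2 * gap_width s / 3 < u}"
        by (intro open_Collect_less continuous_intros)
      show "y \<in> {u. cell_len (Suc s) + 2 * gap_width s / 3 < u}" using 2 g by simp
      show "digit_fun s u = 1 \<and> sign_fun s u = 1" if
          "u \<in> {u. cell_len (Suc s) + 2 * gap_width s / 3 < u}" for u
        using that by (intro digit_sign_outer) simp_all
    qed
  next
    case 3
    show ?thesis
    proof (rule *)
      show "open {u. cell_len (Suc s) + 2 * gap_width s / 3 < - u}"
        by (intro open_Collect_less continuous_intros)
      show "y \<in> {u. cell_len (Suc s) + 2 * gap_width s / 3 < - u}" using 3 g by simp
      show "digit_fun s u = -1 \<and> sign_fun s u = 1" if
          "u \<in> {u. cell_len (Suc s) + 2 * gap_width s / 3 < - u}" for u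
        using that by (intro digit_sign_outer) simp_all
    qed
  qed
qed

lemma in_gap_digits_affine:
  assumes "in_gap s y" and "\<phi> = digit_fun s \<or> \<phi> = sign_fun s"
  obtains a b l c where "\<bar>b\<bar> \<le> 2" "\<bar>l\<bar> = 1 / gap_width s"
      "\<forall>\<^sub>F u in nhds y. \<phi> u = a + b * smooth_step (l * u + c)"
proof -
  obtain \<sigma> where \<sigma>: "\<bar>\<sigma>\<bar> = 1" "\<sigma> * y > cell_len (Suc s)"
    using in_gapE[OF assms(1)] by (metis abs_minus)
  have "\<sigma> * y > 0" using \<sigma> cell_len_pos[of "Suc s"] by linarith
  moreover have "isCont (\<lambda>u. \<sigma> * u) y" by (intro continuous_intros)
  ultimately have "\<forall>\<^sub>F u in nhds y. \<sigma> * u > 0"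
    by (simp add: eventually_nhds_conv_at isCont_def order_tendstoD)
  then have ev: "\<forall>\<^sub>F u in nhds y. digit_fun s u = 0 + \<sigma> * smooth_step ((\<sigma> / gap_width s) * u
      + (- cell_len (Suc s) / gap_width s)) \<and>
                   sign_fun s u = -1 + 2 * smooth_step ((\<sigma> / gap_width s) * u
                       + (- cell_len (Suc s) / gap_width s))"
  proof eventually_elim
    case (elim u)
    have "(\<sigma> * u - cell_len (Suc s)) / gap_width s = (\<sigma> / gap_width s) * u
        + (- cell_len (Suc s) / gap_width s)"
      by (simp add: diff_divide_distrib)
    then show ?case using digit_sign_side[OF \<sigma>(1), of u s] elim by (simp add: gap_step_def)
  qed
  have l: "\<bar>\<sigma> / gap_width s\<bar> = 1 / gap_width s" using \<sigma>(1) gap_width_pos[of s] by simp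
  show ?thesis
  proof (cases "\<phi> = digit_fun s")
    case True
    have "\<forall>\<^sub>F u in nhds y. \<phi> u = 0 + \<sigma> * smooth_step ((\<sigma> / gap_width s) * u
        + (- cell_len (Suc s) / gap_width s))"
      using ev unfolding True by (rule eventually_mono) simp
    from that[OF _ l this] \<sigma>(1) show ?thesis by simp
  next
    case False
    then have "\<phi> = sign_fun s" using assms(2) by simp
    then have "\<forall>\<^sub>F u in nhds y. \<phi> u = -1 + 2 * smooth_step ((\<sigma> / gap_width s) * u
        + (- cell_len (Suc s) / gap_width s))"
      using ev by (auto elim: eventually_mono)
    from that[OF _ l this] show ?thesis by simp
  qed
qed

lemma digit_product_locally_const:
  assumes "finite J" "\<And>i. i \<in> J \<Longrightarrow> \<phi> i = digit_fun (lev i) \<or> \<phi> i = sign_fun (lev i)"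
    and "\<And>i. i \<in> J \<Longrightarrow> \<not> in_gap (lev i) (local_coord (lev i) y)"
  shows "\<forall>\<^sub>F u in nhds y. (\<Prod>i\<in>J. \<phi> i (local_coord (lev i) u)) = (\<Prod>i\<in>J. \<phi> i (local_coord (lev i) y))"
proof -
  have "\<forall>\<^sub>F u in nhds y. \<phi> i (local_coord (lev i) u) = \<phi> i (local_coord (lev i) y)" if "i \<in> J" for i
  proof -
    have "filterlim (local_coord (lev i)) (nhds (local_coord (lev i) y)) (nhds y)"
      using isCont_local_coord[of y "lev i"] by (simp add: isCont_def tendsto_at_iff_tendsto_nhds)
    from eventually_compose_filterlim[OF digit_sign_locally_const[OF assms(3)[OF that]] this]
    show ?thesis using assms(2)[OF that] by (auto elim: eventually_mono)
  qed
  then have "\<forall>\<^sub>F u in nhds y. \<forall>i\<in>J. \<phi> i (local_coord (lev i) u) = \<phi> i (local_coord (lev i) y)"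
    using assms(1) by (simp add: eventually_ball_finite)
  then show ?thesis by eventually_elim (rule prod.cong; simp)
qed

lemma digit_product_bound:
  assumes "\<And>i. i \<in> J \<Longrightarrow> \<phi> i = digit_fun (lev i) \<or> \<phi> i = sign_fun (lev i)"
  shows "\<bar>\<Prod>i\<in>J. \<phi> i (local_coord (lev i) y)\<bar> \<le> 1"
  using assms digit_sign_bounds by (intro prod_abs_le_1) metis

lemma local_stepI:
  "\<forall>\<^sub>F u in nhds y. f u = a + b * smooth_step (l * u + c) \<Longrightarrow> \<bar>b\<bar> \<le> 2 \<Longrightarrow> \<bar>l\<bar> \<le> \<Gamma> \<Longrightarrow> local_step \<Gamma> f y"
  unfolding local_step_def by blast

text \<open>
  At each point at most one level is inside a gap. The factors of the other levels are constant nearby and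
  bounded by 1, so only one rescaled transition is left.
\<close>

lemma digit_product_local_step:
  assumes J: "finite J" "inj_on lev J" and \<phi>: "\<And>i. i \<in> J
      \<Longrightarrow> \<phi> i = digit_fun (lev i) \<or> \<phi> i = sign_fun (lev i)"
    and \<Gamma>: "\<And>i. i \<in> J \<Longrightarrow> 1 / gap_width (lev i) \<le> \<Gamma>" "\<Gamma> \<ge> 0"
  shows "local_step \<Gamma> (\<lambda>u. \<Prod>i\<in>J. \<phi> i (local_coord (lev i) u)) y"
proof (cases "\<exists>i\<in>J. in_gap (lev i) (local_coord (lev i) y)")
  case False
  have "\<forall>\<^sub>F u in nhds y. (\<Prod>i\<in>J. \<phi> i (local_coord (lev i) u)) = (\<Prod>i\<in>J. \<phi> i (local_coord (lev i) y))
      + 0 * smooth_step (0 * u + 0)"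
    using digit_product_locally_const[OF J(1) \<phi>, where y = y] False by simp
  moreover have "\<bar>0::real\<bar> \<le> 2" "\<bar>0::real\<bar> \<le> \<Gamma>" using \<Gamma>(2) by auto
  ultimately show ?thesis by (intro local_stepI)
next
  case True
  then obtain k where k: "k \<in> J" "in_gap (lev k) (local_coord (lev k) y)" by blast
  have others: "\<not> in_gap t (local_coord t y)" if "t \<noteq> lev k" for t using in_gap_unique[OF k(2)] that
      by blast
  define P where "P = (\<Prod>i\<in>J-{k}. \<phi> i (local_coord (lev i) y))"
  have P: "\<bar>P\<bar> \<le> 1" unfolding P_def by (rule digit_product_bound) (use \<phi> in blast)
  have ev1: "\<forall>\<^sub>F u in nhds y. (\<Prod>i\<in>J-{k}. \<phi> i (local_coord (lev i) u)) = P"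
    unfolding P_def
  proof (rule digit_product_locally_const)
    show "\<not> in_gap (lev i) (local_coord (lev i) y)" if "i \<in> J - {k}" for i
      using that inj_onD[OF J(2) _ _ k(1), of i] by (intro others) blast
  qed (use J(1) in simp, use \<phi> in blast)
  obtain e c where e: "\<bar>e\<bar> = 1" and ev2: "\<forall>\<^sub>F u in nhds y. local_coord (lev k) u = e * u + c"
    by (rule local_coord_local_affine[of "lev k" y]) (simp_all add: others)
  obtain a b l d where bl: "\<bar>b\<bar> \<le> 2" "\<bar>l\<bar> = 1 / gap_width (lev k)"
    and ev3: "\<forall>\<^sub>F z in nhds (local_coord (lev k) y). \<phi> k z = a + b * smooth_step (l * z + d)"
    by (rule in_gap_digits_affine[OF k(2) \<phi>[OF k(1)]])
  have "filterlim (local_coord (lev k)) (nhds (local_coord (lev k) y)) (nhds y)"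
    using isCont_local_coord[of y "lev k"] by (simp add: isCont_def tendsto_at_iff_tendsto_nhds)
  from eventually_compose_filterlim[OF ev3 this]
  have "\<forall>\<^sub>F u in nhds y. (\<Prod>i\<in>J. \<phi> i (local_coord (lev i) u)) = P * a
      + (P * b) * smooth_step ((l * e) * u + (l * c + d))"
    using ev1 ev2
  proof eventually_elim
    case (elim u)
    have "(\<Prod>i\<in>J. \<phi> i (local_coord (lev i) u)) = \<phi> k (local_coord (lev k) u) * P"
      using elim(2) by (simp only: prod.remove[OF J(1) k(1)])
    also have "\<dots> = (a + b * smooth_step (l * (e * u + c) + d)) * P"
        by (simp only: elim(1) elim(3)[symmetric])
    finally show ?case by (simp add: algebra_simps)
  qed
  moreover have "\<bar>P * b\<bar> \<le> 2"
    using mult_mono[OF P bl(1)] by (simp add: abs_mult)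
  moreover have "\<bar>l * e\<bar> \<le> \<Gamma>" using \<Gamma>(1)[OF k(1)] bl(2) e by (simp add: abs_mult)
  ultimately show ?thesis by (intro local_stepI)
qed

text \<open>
  Describing the set by the gaps that it avoids makes its closedness evident. That its points are
  exactly the values of digit sequences is \<open>cantor_local_coord_eq\<close> and \<open>cantor_exists\<close>.
\<close>

definition cantor :: "real set" where
  "cantor = {y. \<bar>y\<bar> \<le> cell_len 0 \<and> (\<forall>s. \<not> in_gap s (local_coord s y))}"

definition cantor_digit :: "real \<Rightarrow> nat \<Rightarrow> real" where "cantor_digit y s = digit_fun s (local_coord s y)"

lemma digit_step:
  assumes "\<bar>z\<bar> \<le> cell_len s" "\<not> in_gap s z"
  shows "trit (digit_fun s z)" "sign_fun s z = orientation (digit_fun s z)"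
      "\<bar>cell_fold s z\<bar> \<le> cell_len (Suc s)"
    "z = digit_fun s z * (cell_len s - cell_len (Suc s)) + sign_fun s z * cell_fold s z"
proof -
  consider "\<bar>z\<bar> \<le> cell_len (Suc s)" | "z \<ge> cell_len s - 2 * cell_len (Suc s)" |
      "- z \<ge> cell_len s - 2 * cell_len (Suc s)"
    using assms unfolding in_gap_def by argo
  then have "trit (digit_fun s z) \<and> sign_fun s z = orientation (digit_fun s z) \<and> \<bar>cell_fold s z\<bar>
      \<le> cell_len (Suc s) \<and>
    z = digit_fun s z * (cell_len s - cell_len (Suc s)) + sign_fun s z * cell_fold s z"
  proof cases
    case 1
    then have "digit_fun s z = 0 \<and> sign_fun s z = -1" using gap_width_pos[of s]
        by (intro digit_sign_middle) auto
    moreover have "cell_fold s z = - z" using 1 cell_len_Suc_half[of s]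
        by (intro cell_fold_eq(3)) (rule order_trans)
    ultimately show ?thesis using 1 by (auto simp: trit_def orientation_def)
  next
    case 2
    then have "digit_fun s z = 1 \<and> sign_fun s z = 1" by (intro digit_sign_far) auto
    moreover have "cell_fold s z = z - (cell_len s - cell_len (Suc s))"
      using order_trans[OF cell_len_outer_half 2] by (rule cell_fold_eq(1))
    moreover have "z \<le> cell_len s" using assms(1) by simp
    ultimately show ?thesis using 2 by (auto simp: trit_def orientation_def)
  next
    case 3
    then have "digit_fun s z = -1 \<and> sign_fun s z = 1" by (intro digit_sign_far) auto
    moreover have "cell_fold s z = z + (cell_len s - cell_len (Suc s))"
      using order_trans[OF cell_len_outer_half 3] by (rule cell_fold_eq(2))
    moreover have "- z \<le> cell_len s" using assms(1) by simp
    ultimately show ?thesis using 3 by (auto simp: trit_def orientation_def)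
  qed
  then show "trit (digit_fun s z)" "sign_fun s z = orientation (digit_fun s z)"
      "\<bar>cell_fold s z\<bar> \<le> cell_len (Suc s)"
    "z = digit_fun s z * (cell_len s - cell_len (Suc s)) + sign_fun s z * cell_fold s z" by blast+
qed

lemma cantor_local_coord_bound: "y \<in> cantor \<Longrightarrow> \<bar>local_coord s y\<bar> \<le> cell_len s"
  by (induction s) (auto simp: cantor_def intro: digit_step(3))

lemma cantor_digits:
  assumes "y \<in> cantor"
  shows "trit (cantor_digit y s)" "sign_fun s (local_coord s y) = orientation (cantor_digit y s)"
    "local_coord s y = cantor_digit y s * (cell_len s - cell_len (Suc s))
        + orientation (cantor_digit y s) * local_coord (Suc s) y"
  using digit_step[OF cantor_local_coord_bound[OF assms]] assms
      by (auto simp: cantor_def cantor_digit_def)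

lemma cantor_local_coord_eq:
  assumes "y \<in> cantor"
  shows "local_coord s y = mirrored_value (\<lambda>i. cell_len (i + s)) (\<lambda>i. cantor_digit y (i + s))"
  using signed_series_unique[OF shrinking_tail[OF shrinking_cell_len, of s]
      trit_digits_ok[of "\<lambda>i. cantor_digit y (i + s)"], of "\<lambda>i. local_coord (i + s) y"]
    cantor_digits[OF assms] cantor_local_coord_bound[OF assms] by (metis add_0 add_Suc)

lemma cantor_inj: "y \<in> cantor \<Longrightarrow> y' \<in> cantor \<Longrightarrow> (\<And>s. cantor_digit y s = cantor_digit y' s) \<Longrightarrow> y = y'"
  using cantor_local_coord_eq[of y 0] cantor_local_coord_eq[of y' 0] by simp

lemma cantor_tail_const:
  assumes "y \<in> cantor" "\<And>t. t \<ge> s \<Longrightarrow> cantor_digit y t = c" "\<bar>c\<bar> = 1"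
  shows "local_coord s y = c * cell_len s"
proof -
  have "local_coord s y = signed_series (\<lambda>i. cell_len (i + s)) (\<lambda>i. c) (\<lambda>i. 1)"
    using cantor_local_coord_eq[OF assms(1), of s] assms(2,3) by (simp add: orientation_def)
  then show ?thesis using signed_series_const[OF shrinking_tail[OF shrinking_cell_len, of s]] by simp
qed

text \<open>
  The tails of the series given by the digits are the local coordinates of its value.
\<close>

lemma cantor_exists:
  assumes "\<And>s. trit (e s)"
  obtains y where "y \<in> cantor" "\<And>s. cantor_digit y s = e s"
proof -
  define T where "T s = mirrored_value (\<lambda>i. cell_len (i + s)) (\<lambda>i. e (i + s))" for s
  have sh: "shrinking (\<lambda>i. cell_len (i + s))" for s by (rule shrinking_tail[OF shrinking_cell_len])
  have ok: "digits_ok (\<lambda>i. e (i + s)) (\<lambda>i. orientation (e (i + s)))" for s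
    using assms by (intro trit_digits_ok) auto
  have Trec: "T s = e s * (cell_len s - cell_len (Suc s)) + orientation (e s) * T (Suc s)" for s
    using signed_series_rec[OF sh ok, of s s] by (simp add: T_def)
  have Tb: "\<bar>T s\<bar> \<le> cell_len s" for s using signed_series_bound[OF sh ok, of s s] by (simp add: T_def)
  have step: "cell_fold s (T s) = T (Suc s) \<and> \<not> in_gap s (T s) \<and> digit_fun s (T s) = e s" for s
  proof -
    note l = cell_len_Suc[of s] cell_len_pos[of "Suc s"] gap_width_pos[of s] Tb[of "Suc s"]
    consider "e s = 0" | "e s = 1" | "e s = -1" using assms[of s] by (auto simp: trit_def)
    then show ?thesis
    proof cases
      case 1
      then have T: "T s = - T (Suc s)" using Trec[of s] by (simp add: orientation_def)
      then have "\<bar>T s\<bar> = \<bar>T (Suc s)\<bar>" by simp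
      then have "cell_fold s (T s) = - T s" using l(4) order_trans[OF _ cell_len_Suc_half[of s]]
          by (intro cell_fold_eq(3)) simp
      moreover have "digit_fun s (T s) = 0" using digit_sign_middle[of "T s" s] l T by simp
      ultimately show ?thesis using 1 T l by (simp add: in_gap_def)
    next
      case 2
      then have T: "T s = cell_len s - cell_len (Suc s) + T (Suc s)" using Trec[of s]
          by (simp add: orientation_def)
      have outer: "cell_len s - 2 * cell_len (Suc s) \<le> T s" using l T by linarith
      have "cell_fold s (T s) = T s - (cell_len s - cell_len (Suc s))"
        using order_trans[OF cell_len_outer_half outer] by (rule cell_fold_eq(1))
      moreover have "digit_fun s (T s) = 1" using digit_sign_far[of 1 s "T s"] l T by simp
      moreover have "\<bar>T s\<bar> \<ge> cell_len s - 2 * cell_len (Suc s)" using l T by linarith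
      ultimately show ?thesis using 2 T by (simp add: in_gap_def)
    next
      case 3
      then have T: "T s = - (cell_len s - cell_len (Suc s)) + T (Suc s)" using Trec[of s]
          by (simp add: orientation_def)
      have outer: "cell_len s - 2 * cell_len (Suc s) \<le> - T s" using l T by linarith
      have "cell_fold s (T s) = T s + (cell_len s - cell_len (Suc s))"
        using order_trans[OF cell_len_outer_half outer] by (rule cell_fold_eq(2))
      moreover have "digit_fun s (T s) = -1" using digit_sign_far[of "-1" s "T s"] l T by simp
      moreover have "\<bar>T s\<bar> \<ge> cell_len s - 2 * cell_len (Suc s)" using l T by linarith
      ultimately show ?thesis using 3 T by (simp add: in_gap_def)
    qed
  qed
  have local_coord: "local_coord s (T 0) = T s" for s by (induction s) (use step in auto)
  show ?thesis
    by (rule that[of "T 0"]) (use local_coord step Tb[of 0] in \<open>auto simp: cantor_def cantor_digit_def\<close>)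
qed

lemma closed_cantor: "closed cantor"
proof -
  have c: "continuous_on UNIV (local_coord s)" for s
    using isCont_local_coord by (simp add: continuous_at_imp_continuous_on)
  have "closed ({y. \<bar>local_coord s y\<bar> \<le> cell_len (Suc s)} \<union> {y. cell_len s - 2 * cell_len (Suc s)
      \<le> \<bar>local_coord s y\<bar>})" for s
    by (intro closed_Un closed_Collect_le continuous_intros c)
  then have "closed ({y. \<bar>y\<bar> \<le> cell_len 0} \<inter>
      (\<Inter>s. {y. \<bar>local_coord s y\<bar> \<le> cell_len (Suc s)} \<union> {y. cell_len s - 2 * cell_len (Suc s)
          \<le> \<bar>local_coord s y\<bar>}))"
    by (intro closed_Int closed_INT ballI closed_Collect_le continuous_intros c)
  also have "\<dots> = cantor" unfolding cantor_def in_gap_def by (auto simp: not_less)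
  finally show ?thesis .
qed

lemma cantor_subset: "cantor \<subseteq> {- 2..2}"
  unfolding cantor_def cell_len_def by auto

text \<open>
  Points with the same digit lie in one of the three convex pieces on which the folding is affine.
\<close>

lemma cell_fold_same_digit_affine:
  assumes "\<bar>z\<bar> \<le> cell_len s" "\<not> in_gap s z" "\<bar>z'\<bar> \<le> cell_len s" "\<not> in_gap s z'"
      "digit_fun s z = digit_fun s z'" "0 \<le> u" "u \<le> 1"
  shows "cell_fold s ((1 - u) * z + u * z') = (1 - u) * cell_fold s z + u * cell_fold s z'"
proof -
  let ?w = "(1 - u) * z + u * z'"
  define h where "h = (cell_len s - cell_len (Suc s)) / 2"
  note l = cell_len_Suc[of s] cell_len_pos[of "Suc s"]
  have dz: "\<bar>x\<bar> \<le> h \<and> digit_fun s x = 0 \<or> x \<ge> h \<and> digit_fun s x = 1 \<or> - x \<ge> h \<and> digit_fun s x = -1"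
    if x: "\<bar>x\<bar> \<le> cell_len s" "\<not> in_gap s x" for x
  proof -
    consider "\<bar>x\<bar> \<le> cell_len (Suc s)" | "x \<ge> cell_len s - 2 * cell_len (Suc s)" |
        "- x \<ge> cell_len s - 2 * cell_len (Suc s)"
      using x unfolding in_gap_def by argo
    then show ?thesis
    proof cases
      case 1
      then have "digit_fun s x = 0" using digit_sign_middle[of x s] gap_width_pos[of s] by simp
      moreover have "\<bar>x\<bar> \<le> h" using 1 cell_len_Suc_half[of s] unfolding h_def by (rule order_trans)
      ultimately show ?thesis by blast
    next
      case 2
      then have "digit_fun s x = 1" using digit_sign_far[of 1 s x] by simp
      moreover have "x \<ge> h" using order_trans[OF cell_len_outer_half 2] unfolding h_def .
      ultimately show ?thesis by blast
    next
      case 3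
      then have "digit_fun s x = -1" using digit_sign_far[of "-1" s x] by simp
      moreover have "- x \<ge> h" using order_trans[OF cell_len_outer_half 3] unfolding h_def .
      ultimately show ?thesis by blast
    qed
  qed
  have cv: "?w \<in> S" if "convex S" "z \<in> S" "z' \<in> S" for S
    using that assms(6,7) by (auto simp: convex_alt)
  consider "z \<in> {-h..h}" "z' \<in> {-h..h}" | "z \<in> {h..}" "z' \<in> {h..}" | "z \<in> {..-h}" "z' \<in> {..-h}"
    using dz[OF assms(1,2)] dz[OF assms(3,4)] assms(5) by (elim disjE conjE) (simp_all add: abs_le_iff)
  then show ?thesis
  proof cases
    case 1
    have "cell_fold s x = - x" if "x \<in> {-h..h}" for x
    proof -
      have "\<bar>x\<bar> \<le> h" using that by auto
      then show ?thesis using cell_fold_eq(3)[of x s] by (simp only: h_def)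
    qed
    from this[OF cv[OF _ 1]] this[OF 1(1)] this[OF 1(2)] show ?thesis by (simp add: algebra_simps)
  next
    case 2
    have "cell_fold s x = x - (cell_len s - cell_len (Suc s))" if "x \<in> {h..}" for x
      using that cell_fold_eq(1)[of s x] by (simp only: h_def atLeast_iff)
    note this[OF cv[OF _ 2]] this[OF 2(1)] this[OF 2(2)]
    then show ?thesis by (simp only: convex_real_interval) (simp add: algebra_simps)
  next
    case 3
    have "cell_fold s x = x + (cell_len s - cell_len (Suc s))" if "x \<in> {..-h}" for x
    proof -
      have "- x \<ge> h" using that by simp
      then show ?thesis using cell_fold_eq(2)[of s x] by (simp only: h_def)
    qed
    note this[OF cv[OF _ 3]] this[OF 3(1)] this[OF 3(2)]
    then show ?thesis by (simp only: convex_real_interval) (simp add: algebra_simps)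
  qed
qed

lemma local_coord_same_prefix_affine:
  assumes "y \<in> cantor" "y' \<in> cantor" "\<And>t. t < s \<Longrightarrow> cantor_digit y t = cantor_digit y' t" "0 \<le> u" "u \<le> 1"
  shows "local_coord s ((1 - u) * y + u * y') = (1 - u) * local_coord s y + u * local_coord s y'"
  using assms(3)
proof (induction s)
  case (Suc s)
  then show ?case
    using cell_fold_same_digit_affine[OF cantor_local_coord_bound[OF assms(1)] _ cantor_local_coord_bound[OF assms(2)] _ _ assms(4,5), of s]
      assms(1,2) by (auto simp: cantor_def cantor_digit_def)
qed simp

text \<open>
  The common prefix makes the local coordinate of level \<open>s\<close> affine between the two points, and the common
  tail places them at the two ends of one gap.
\<close>

lemma gap_crossing:
  assumes y: "y \<in> cantor" "y' \<in> cantor" "\<And>t. t < s \<Longrightarrow> cantor_digit y t = cantor_digit y' t"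
    and c: "\<bar>c\<bar> = 1" "{cantor_digit y s, cantor_digit y' s} = {0, - c}" "\<And>t. t > s
        \<Longrightarrow> cantor_digit y t = c \<and> cantor_digit y' t = c"
    and u: "0 < u" "u < 1"
  defines "z \<equiv> (1 - u) * y + u * y'"
  shows "cell_len (Suc s) < - c * local_coord s z"
      "- c * local_coord s z < cell_len s - 2 * cell_len (Suc s)"
proof -
  have tails: "local_coord (Suc s) y = c * cell_len (Suc s)"
      "local_coord (Suc s) y' = c * cell_len (Suc s)"
    by (rule cantor_tail_const; use y c in auto)+
  have ends: "- c * local_coord s x = cell_len (Suc s) \<and> cantor_digit x s = 0
      \<or> - c * local_coord s x = cell_len s - 2 * cell_len (Suc s) \<and> cantor_digit x s = - c"
    if "x \<in> cantor" "local_coord (Suc s) x = c * cell_len (Suc s)" "cantor_digit x s \<in> {0, - c}" for x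
  proof -
    have "local_coord s x = cantor_digit x s * (cell_len s - cell_len (Suc s))
        + orientation (cantor_digit x s) * (c * cell_len (Suc s))"
      using cantor_digits(3)[OF that(1), of s] that(2) by simp
    moreover have "c = 1 \<or> c = -1" using c(1) by auto
    ultimately show ?thesis using that(3) by (auto simp: orientation_def)
  qed
  define a b where "a = - c * local_coord s y" and "b = - c * local_coord s y'"
  have "cantor_digit y s \<noteq> cantor_digit y' s" 
  proof
    assume "cantor_digit y s = cantor_digit y' s"
    with c(2) have "0 = - c" by (metis insert_absorb2 insert_iff singletonD)
    with c(1) show False by simp
  qed
  then have ab: "a = cell_len (Suc s) \<and> b = cell_len s - 2 * cell_len (Suc s) \<or> b = cell_len (Suc s)
      \<and> a = cell_len s - 2 * cell_len (Suc s)"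
    using ends[OF y(1) tails(1)] ends[OF y(2) tails(2)] c(2) unfolding a_def b_def by (metis insertCI)
  have yz: "local_coord s z = (1 - u) * local_coord s y + u * local_coord s y'" unfolding z_def
    by (rule local_coord_same_prefix_affine) (use y u in auto)
  have z: "- c * local_coord s z = (1 - u) * a + u * b" unfolding a_def b_def yz
      by (simp add: algebra_simps)
  define g where "g = cell_len s - 3 * cell_len (Suc s)"
  have g: "g > 0" "cell_len s = 3 * cell_len (Suc s) + g" using cell_len_Suc[of s] by (auto simp: g_def)
  have "0 < u * g" "0 < (1 - u) * g" using u g(1) by simp_all
  moreover have "- c * local_coord s z = cell_len (Suc s) + u * g \<or> - c * local_coord s z
      = cell_len (Suc s) + (1 - u) * g"
    using ab unfolding z g(2) by (auto simp: algebra_simps)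
  moreover have "(1 - u) * g = g - u * g" by (simp add: algebra_simps)
  ultimately show "cell_len (Suc s) < - c * local_coord s z"
      "- c * local_coord s z < cell_len s - 2 * cell_len (Suc s)"
    unfolding g(2) by linarith+
qed

section \<open>Smooth series over a stream of digits\<close>

lemma axis_line_vector_derivative:
  fixes f :: "real^'m::finite \<Rightarrow> 'b::real_normed_vector"
  assumes "(f has_derivative (\<lambda>h. \<Sum>u\<in>UNIV. h $ u *\<^sub>R g u)) (at (x + s *\<^sub>R axis t 1))"
  shows "((\<lambda>s. f (x + s *\<^sub>R axis t 1)) has_vector_derivative g t) (at s)"
proof -
  have "((\<lambda>s. x + s *\<^sub>R axis t 1) has_derivative (\<lambda>h. h *\<^sub>R axis t 1)) (at s)"
    by (auto intro!: derivative_eq_intros)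
  from has_derivative_compose[OF this assms]
  have "((\<lambda>s. f (x + s *\<^sub>R axis t 1))
      has_derivative (\<lambda>h. \<Sum>u\<in>UNIV. (h *\<^sub>R axis t 1) $ u *\<^sub>R g u)) (at s)" .
  moreover have "(\<Sum>u\<in>UNIV. (h *\<^sub>R axis t 1) $ u *\<^sub>R g u) = h *\<^sub>R g t" for h
  proof -
    have "(\<Sum>u\<in>UNIV. (h *\<^sub>R axis t 1) $ u *\<^sub>R g u) = (\<Sum>u\<in>UNIV. if u = t then h *\<^sub>R g u else 0)"
      by (rule sum.cong) (auto simp: axis_def)
    then show ?thesis by simp
  qed
  ultimately show ?thesis by (simp add: has_vector_derivative_def)
qed

lemma axis_line_DERIV:
  fixes f :: "real^'m::finite \<Rightarrow> real"
  assumes "(f has_derivative (\<lambda>h. \<Sum>u\<in>UNIV. h $ u * g u)) (at (x + s *\<^sub>R axis t 1))"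
  shows "((\<lambda>s. f (x + s *\<^sub>R axis t 1)) has_real_derivative g t) (at s)"
  using axis_line_vector_derivative[of f g x s t] assms
      by (simp add: has_real_derivative_iff_has_vector_derivative)

text \<open>
  The \<open>i\<close>-th digit of the stream is the digit of level \<open>lev i\<close> of the coordinate \<open>co i\<close> of a point. The number
  \<open>\<Gamma> q\<close> bounds the factor that one derivative costs when only the first \<open>q + 1\<close> digits are involved.
\<close>

locale digit_stream =
  fixes co :: "nat \<Rightarrow> 'm::finite" and lev :: "nat \<Rightarrow> nat" and \<Gamma> :: "nat \<Rightarrow> real" and \<kappa> :: real
  assumes inj_place: "\<And>i k. co i = co k \<Longrightarrow> lev i = lev k \<Longrightarrow> i = k"
    and gap_bound: "\<And>i q. i \<le> q \<Longrightarrow> 1 / gap_width (lev i) \<le> \<Gamma> q"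
    and \<Gamma>_ge_1: "\<And>q. \<Gamma> q \<ge> 1"
    and \<Gamma>_summable: "\<And>\<theta>. 0 \<le> \<theta> \<Longrightarrow> \<theta> < \<kappa> \<Longrightarrow> summable (\<lambda>q. triadic_len q * \<Gamma> q powr \<theta>)"
begin

definition stream_digit :: "real^'m \<Rightarrow> nat \<Rightarrow> real" where
    "stream_digit x i = digit_fun (lev i) (local_coord (lev i) (x $ co i))"
definition stream_sign :: "real^'m \<Rightarrow> nat \<Rightarrow> real" where
    "stream_sign x i = sign_fun (lev i) (local_coord (lev i) (x $ co i))"

text \<open>
  The term number \<open>q\<close> of the series is a product over the digits up to \<open>q\<close>. Grouping the digits by
  their coordinate splits it into functions of one variable.
\<close>

definition factor :: "nat \<Rightarrow> 'm \<Rightarrow> real \<Rightarrow> real" where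
  "factor q t y = (\<Prod>i\<in>{i. i \<le> q \<and> co i
      = t}. (if i < q then sign_fun (lev i) else digit_fun (lev i)) (local_coord (lev i) y))"

text \<open>
  The mixed partial derivative along the list \<open>is\<close> of a product of functions of one variable.
\<close>

definition series_term :: "nat \<Rightarrow> 'm list \<Rightarrow> real^'m \<Rightarrow> real" where
  "series_term q is x = (\<Prod>t\<in>UNIV. (deriv ^^ count_list is t) (factor q t) (x $ t))"

definition series :: "'m list \<Rightarrow> real^'m \<Rightarrow> real" where
  "series is x = (\<Sum>q. (triadic_len q - triadic_len (Suc q)) * series_term q is x)"

lemma factor_local_step: "local_step (\<Gamma> q) (factor q t) y"
  unfolding factor_def
proof (rule digit_product_local_step[where \<phi> = "\<lambda>i.
    if i < q then sign_fun (lev i) else digit_fun (lev i)"])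
  show "inj_on lev {i. i \<le> q \<and> co i = t}" by (rule inj_onI) (use inj_place in auto)
  show "\<Gamma> q \<ge> 0" using \<Gamma>_ge_1[of q] by simp
qed (use gap_bound in auto)

lemma factor_bound: "\<bar>factor q t y\<bar> \<le> 1"
  unfolding factor_def
  by (rule digit_product_bound[where \<phi> = "\<lambda>i.
      if i < q then sign_fun (lev i) else digit_fun (lev i)"]) auto

lemma factor_DERIV:
  "((deriv ^^ n) (factor q t) has_real_derivative (deriv ^^ Suc n) (factor q t) y) (at y)"
  by (rule local_step_DERIV[OF factor_local_step])

lemma factor_higher_deriv_bound: "\<exists>C\<ge>1. \<forall>q t y. \<bar>(deriv ^^ n) (factor q t) y\<bar> \<le> C * \<Gamma> q ^ n"
proof -
  obtain C where C: "C \<ge> 1" "\<And>u. \<bar>(deriv ^^ n) smooth_step u\<bar> \<le> C"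
    using higher_deriv_smooth_step_bounded by blast
  have "\<bar>(deriv ^^ n) (factor q t) y\<bar> \<le> (2 * C) * \<Gamma> q ^ n" for q t y
    using local_step_higher_deriv_bound[OF factor_bound factor_local_step C(2,1)] .
  then show ?thesis using C(1) by (intro exI[of _ "2 * C"]) auto
qed

lemma factor_deriv_flat:
  assumes "\<And>i. co i = t \<Longrightarrow> \<not> in_gap (lev i) (local_coord (lev i) y)"
  shows "deriv (factor q t) y = 0"
proof -
  have "\<forall>\<^sub>F u in nhds y. factor q t u = factor q t y"
    unfolding factor_def
    by (rule digit_product_locally_const[where \<phi> = "\<lambda>i.
        if i < q then sign_fun (lev i) else digit_fun (lev i)"])
       (use assms in auto)
  then have "deriv (factor q t) y = deriv (\<lambda>u. factor q t y) y"
    by (rule deriv_cong_ev) simp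
  then show ?thesis by simp
qed

lemma series_term_bound: "\<exists>C\<ge>1. \<forall>q x. \<bar>series_term q is x\<bar> \<le> C * \<Gamma> q ^ length is"
proof -
  have "\<forall>n. \<exists>C\<ge>1. \<forall>q t y. \<bar>(deriv ^^ n) (factor q t) y\<bar> \<le> C * \<Gamma> q ^ n"
    using factor_higher_deriv_bound by blast
  then obtain C where C: "\<And>n. C n \<ge> 1" "\<And>n q t y. \<bar>(deriv ^^ n) (factor q t) y\<bar> \<le> C n * \<Gamma> q ^ n"
    by metis
  define K where "K = (\<Prod>t\<in>(UNIV::'m set). C (count_list is t))"
  have "\<bar>series_term q is x\<bar> \<le> K * \<Gamma> q ^ length is" for q x
  proof -
    have "\<bar>series_term q is x\<bar> \<le> (\<Prod>t\<in>UNIV. C (count_list is t) * \<Gamma> q ^ count_list is t)"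
      unfolding series_term_def abs_prod by (rule prod_mono) (use C(2) in auto)
    also have "\<dots> = K * \<Gamma> q ^ (\<Sum>t\<in>UNIV. count_list is t)"
      by (simp add: K_def prod.distrib power_sum)
    also have "(\<Sum>t\<in>UNIV. count_list is t) = length is" by (rule sum_count_set) auto
    finally show ?thesis .
  qed
  moreover have "K \<ge> 1" unfolding K_def using C(1) by (intro prod_ge_1) auto
  ultimately show ?thesis by blast
qed

lemma series_term_has_derivative:
  "(series_term q is has_derivative (\<lambda>h. \<Sum>t\<in>UNIV. h $ t * series_term q (t # is) x)) (at x)"
proof -
  let ?f = "\<lambda>t x. (deriv ^^ count_list is t) (factor q t) (x $ t)"
  let ?f' = "\<lambda>t h. (deriv ^^ Suc (count_list is t)) (factor q t) (x $ t) * h $ t"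
  have "(?f t has_derivative ?f' t) (at x)" for t
  proof -
    have "((\<lambda>x. x $ t) has_derivative (\<lambda>h. h $ t)) (at x)"
      by (rule bounded_linear.has_derivative[OF bounded_linear_vec_nth has_derivative_ident])
    from has_derivative_compose[OF this] factor_DERIV[of "count_list is t" q t "x $ t"]
    show ?thesis by (simp add: has_field_derivative_def)
  qed
  then have "((\<lambda>x. \<Prod>t\<in>UNIV. ?f t x)
      has_derivative (\<lambda>h. \<Sum>t\<in>UNIV. ?f' t h * (\<Prod>u\<in>UNIV - {t}. ?f u x))) (at x)"
    by (rule has_derivative_prod)
  moreover have "(\<Sum>t\<in>UNIV. ?f' t h * (\<Prod>u\<in>UNIV - {t}. ?f u x))
      = (\<Sum>t\<in>UNIV. h $ t * series_term q (t # is) x)" for h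
  proof (rule sum.cong[OF refl])
    fix t
    show "?f' t h * (\<Prod>u\<in>UNIV - {t}. ?f u x) = h $ t * series_term q (t # is) x"
    proof -
    have "series_term q (t # is) x = (deriv ^^ count_list (t # is) t) (factor q t) (x $ t) *
        (\<Prod>u\<in>UNIV - {t}. (deriv ^^ count_list (t # is) u) (factor q u) (x $ u))"
      unfolding series_term_def by (rule prod.remove) auto
    also have "(\<Prod>u\<in>UNIV - {t}. (deriv ^^ count_list (t # is) u) (factor q u) (x $ u))
        = (\<Prod>u\<in>UNIV - {t}. ?f u x)"
      by (rule prod.cong) auto
    finally show ?thesis by (simp del: funpow.simps)
    qed
  qed
  moreover have "series_term q is = (\<lambda>x. \<Prod>t\<in>UNIV. ?f t x)" by (auto simp: series_term_def)
  ultimately show ?thesis by (simp only:)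
qed

lemma triadic_len_weight: "triadic_len q - triadic_len (Suc q) = 2 / 3 * triadic_len q"
    by (simp add: triadic_len_def)

lemma weighted_summable:
  assumes "0 \<le> \<theta>" "\<theta> < \<kappa>"
  shows "summable (\<lambda>q. (triadic_len q - triadic_len (Suc q)) * (C * \<Gamma> q powr \<theta>))"
proof -
  have "summable (\<lambda>q. (2 / 3 * C) * (triadic_len q * \<Gamma> q powr \<theta>))"
    by (rule summable_mult[OF \<Gamma>_summable[OF assms]])
  then show ?thesis by (simp add: triadic_len_weight mult_ac)
qed

lemma powr_nat: "\<Gamma> q ^ n = \<Gamma> q powr (real n)"
  using \<Gamma>_ge_1[of q] by (simp add: powr_realpow)

lemma weight_pos: "triadic_len q - triadic_len (Suc q) > 0"
    by (simp add: triadic_len_weight) (simp add: triadic_len_def)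

lemma series_dominated:
  assumes "real (length is) < \<kappa>"
  obtains M where "summable M" "\<And>q x. \<bar>(triadic_len q - triadic_len (Suc q)) * series_term q is x\<bar>
      \<le> M q"
proof -
  obtain C where C: "\<And>q x. \<bar>series_term q is x\<bar> \<le> C * \<Gamma> q powr (real (length is))"
    using series_term_bound[of "is"] unfolding powr_nat by blast
  show ?thesis
  proof (rule that)
    show "summable (\<lambda>q. (triadic_len q - triadic_len (Suc q)) * (C * \<Gamma> q powr (real (length is))))"
      by (rule weighted_summable) (use assms in auto)
    show "\<bar>(triadic_len q - triadic_len (Suc q)) * series_term q is x\<bar>
        \<le> (triadic_len q - triadic_len (Suc q)) * (C * \<Gamma> q powr (real (length is)))" for q x
      using weight_pos[of q] C by (simp add: abs_mult mult_left_mono)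
  qed
qed

lemma series_summable:
  assumes "real (length is) < \<kappa>"
  shows "summable (\<lambda>q. (triadic_len q - triadic_len (Suc q)) * series_term q is x)"
proof -
  obtain M where M: "summable M"
      "\<And>q x. \<bar>(triadic_len q - triadic_len (Suc q)) * series_term q is x\<bar> \<le> M q"
    using series_dominated[OF assms] by blast
  show ?thesis by (rule summable_comparison_test'[OF M(1)]) (simp only: real_norm_def M(2))
qed

lemma series_uniform_limit:
  assumes "real (length is) < \<kappa>"
  shows "uniform_limit UNIV (\<lambda>n x. \<Sum>q<n. (triadic_len q - triadic_len (Suc q)) * series_term q is x) (series is) sequentially"
proof -
  obtain M where M: "summable M"
      "\<And>q x. \<bar>(triadic_len q - triadic_len (Suc q)) * series_term q is x\<bar> \<le> M q"
    using series_dominated[OF assms] by blast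
  show ?thesis unfolding series_def[abs_def]
    by (rule Weierstrass_m_test[OF _ M(1)]) (simp only: real_norm_def M(2))
qed

lemma series_continuous:
  assumes "real (length is) < \<kappa>"
  shows "continuous_on UNIV (series is)"
proof (rule uniform_limit_theorem[OF always_eventually series_uniform_limit[OF assms]])
  have "continuous_on UNIV (series_term q is)" for q
    by (intro continuous_at_imp_continuous_on ballI has_derivative_continuous[OF series_term_has_derivative])
  then show "\<forall>n. continuous_on UNIV (\<lambda>x. \<Sum>q<n. (triadic_len q - triadic_len (Suc q)) * series_term q is x)"
    by (intro allI continuous_on_sum continuous_on_mult_left)
qed simp

lemma series_has_derivative:
  assumes "real (length is) + 1 < \<kappa>"
  shows "(series is has_derivative (\<lambda>h. \<Sum>t\<in>UNIV. h $ t * series (t # is) x)) (at x)"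
proof -
  let ?w = "\<lambda>q. triadic_len q - triadic_len (Suc q)"
  have "\<exists>g. \<forall>x\<in>UNIV. (\<lambda>q. ?w q * series_term q is x) sums g x \<and>
      (g has_derivative (\<lambda>h. \<Sum>t\<in>UNIV. h $ t * series (t # is) x)) (at x within UNIV)"
  proof (rule has_derivative_series)
    show "((\<lambda>x. ?w q * series_term q is x)
        has_derivative (\<lambda>h. ?w q * (\<Sum>t\<in>UNIV. h $ t * series_term q (t # is) x))) (at x within UNIV)"
      for q x using has_derivative_mult_right[OF series_term_has_derivative[of q "is" x], of "?w q"]
          by simp
    show "\<forall>\<^sub>F n in sequentially. \<forall>x\<in>UNIV. \<forall>h. norm ((\<Sum>q<n. ?w q * (\<Sum>t\<in>UNIV. h $ t * series_term q (t # is) x))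
        - (\<Sum>t\<in>UNIV. h $ t * series (t # is) x)) \<le> e * norm h" if "e > 0" for e
    proof -
      define \<epsilon> where "\<epsilon> = e / real CARD('m)"
      have \<epsilon>: "\<epsilon> > 0" using that by (simp add: \<epsilon>_def)
      have "\<forall>\<^sub>F n in sequentially. \<forall>x\<in>UNIV. dist (\<Sum>q<n. ?w q * series_term q (t # is) x) (series (t # is) x) < \<epsilon>" for t
        using series_uniform_limit[of "t # is"] assms \<epsilon> by (auto simp: uniform_limit_iff add.commute)
      then have "\<forall>\<^sub>F n in sequentially. \<forall>t. \<forall>x\<in>UNIV. dist (\<Sum>q<n. ?w q * series_term q (t # is) x) (series (t # is) x) < \<epsilon>"
        by (rule eventually_all_finite)
      then show ?thesis
      proof eventually_elim
        case (elim n)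
        show ?case
        proof (intro ballI allI)
          fix x h
          have "(\<Sum>q<n. ?w q * (\<Sum>t\<in>UNIV. h $ t * series_term q (t # is) x))
              = (\<Sum>t\<in>UNIV. h $ t * (\<Sum>q<n. ?w q * series_term q (t # is) x))"
            unfolding sum_distrib_left by (subst sum.swap) (simp add: mult_ac)
          then have "norm ((\<Sum>q<n. ?w q * (\<Sum>t\<in>UNIV. h $ t * series_term q (t # is) x)) - (\<Sum>t\<in>UNIV. h $ t * series (t # is) x))
            = norm (\<Sum>t\<in>UNIV. h $ t * ((\<Sum>q<n. ?w q * series_term q (t # is) x) - series (t # is) x))"
            by (simp add: sum_subtractf right_diff_distrib)
          also have "\<dots> \<le> (\<Sum>t\<in>(UNIV :: 'm set). norm h * \<epsilon>)"
          proof (rule sum_norm_le)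
            fix t
            have "\<bar>(\<Sum>q<n. ?w q * series_term q (t # is) x) - series (t # is) x\<bar> \<le> \<epsilon>"
              using elim by (auto simp: dist_norm intro: less_imp_le)
            then show "norm (h $ t * ((\<Sum>q<n. ?w q * series_term q (t # is) x) - series (t # is) x))
                \<le> norm h * \<epsilon>"
              unfolding norm_mult by (intro mult_mono) (auto simp: component_le_norm_cart)
          qed
          also have "\<dots> = e * norm h" by (simp add: \<epsilon>_def)
          finally show "norm ((\<Sum>q<n. ?w q * (\<Sum>t\<in>UNIV. h $ t * series_term q (t # is) x)) - (\<Sum>t\<in>UNIV. h $ t * series (t # is) x)) \<le> e * norm h" .
        qed
      qed
    qed
    show "(\<lambda>q. ?w q * series_term q is 0) sums series is 0"
      unfolding series_def by (rule summable_sums[OF series_summable]) (use assms in simp)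
  qed auto
  then obtain g where g: "\<And>x. (\<lambda>q. ?w q * series_term q is x) sums g x"
    "(g has_derivative (\<lambda>h. \<Sum>t\<in>UNIV. h $ t * series (t # is) x)) (at x)" by auto
  have "g = series is" unfolding series_def using g(1) by (auto simp: sums_iff)
  then show ?thesis using g(2) by simp
qed

lemma series_line_DERIV:
  assumes "real (length is) + 1 < \<kappa>"
  shows "((\<lambda>s. series is (x + s *\<^sub>R axis t 1)) has_real_derivative series (t # is) (x
      + s *\<^sub>R axis t 1)) (at s)"
  by (rule axis_line_DERIV[OF series_has_derivative[OF assms]])

text \<open>
  Interpolation: the increment is bounded by the size of the term if \<open>\<Gamma> q * \<bar>s\<bar> \<ge> 1\<close>, and by the mean value
  theorem otherwise.
\<close>

lemma series_term_increment:
  obtains C where "C \<ge> 0" "\<And>q x s t \<theta>. 0 \<le> \<theta> \<Longrightarrow> \<theta> \<le> 1 \<Longrightarrow>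
    \<bar>series_term q is (x + s *\<^sub>R axis t 1) - series_term q is x\<bar> \<le> C * \<Gamma> q powr (real (length is)
        + \<theta>) * \<bar>s\<bar> powr \<theta>"
proof -
  obtain C0 where C0: "C0 \<ge> 1" "\<And>q x. \<bar>series_term q is x\<bar> \<le> C0 * \<Gamma> q ^ length is"
    using series_term_bound by blast
  have "\<forall>t. \<exists>C\<ge>1. \<forall>q x. \<bar>series_term q (t # is) x\<bar> \<le> C * \<Gamma> q ^ Suc (length is)"
    using series_term_bound[of "_ # is"] by simp
  then obtain D where D: "\<And>t. D t \<ge> 1"
      "\<And>t q x. \<bar>series_term q (t # is) x\<bar> \<le> D t * \<Gamma> q ^ Suc (length is)"
    by metis
  define C where "C = 2 * C0 + (\<Sum>t\<in>UNIV. D t)"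
  have D_le: "D t \<le> C" for t
  proof -
    have "D t \<le> (\<Sum>t\<in>UNIV. D t)"
      by (rule member_le_sum) (use D(1) in \<open>auto intro: order_trans[OF zero_le_one]\<close>)
    then show ?thesis unfolding C_def using C0(1) by linarith
  qed
  have C0_le: "2 * C0 \<le> C" unfolding C_def using D(1)
      by (simp add: sum_nonneg order_trans[OF zero_le_one])
  have line: "((\<lambda>s. series_term q is (x
      + s *\<^sub>R axis t 1)) has_real_derivative series_term q (t # is) (x + s *\<^sub>R axis t 1)) (at s)"
    for q x s t by (rule axis_line_DERIV[OF series_term_has_derivative])
  have "\<bar>series_term q is (x + s *\<^sub>R axis t 1) - series_term q is x\<bar>
      \<le> C * \<Gamma> q powr (real (length is) + \<theta>) * \<bar>s\<bar> powr \<theta>"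
    if \<theta>: "0 \<le> \<theta>" "\<theta> \<le> 1" for q x s t \<theta>
  proof (cases "s = 0")
    case True
    then show ?thesis by simp
  next
    case False
    let ?G = "\<Gamma> q" and ?n = "length is"
    have G: "?G \<ge> 1" "?G > 0" using \<Gamma>_ge_1[of q] by auto
    have G': "?G powr (real ?n + \<theta>) * \<bar>s\<bar> powr \<theta> = ?G ^ ?n * (?G * \<bar>s\<bar>) powr \<theta>"
      using G by (simp add: powr_add powr_mult powr_nat)
    have pos: "0 \<le> ?G ^ ?n" using G by simp
    show ?thesis
    proof (cases "?G * \<bar>s\<bar> \<ge> 1")
      case True
      have "\<bar>series_term q is (x + s *\<^sub>R axis t 1) - series_term q is x\<bar> \<le> C0 * ?G ^ ?n + C0 * ?G ^ ?n"
        using C0(2)[of q "x + s *\<^sub>R axis t 1"] C0(2)[of q x] by linarith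
      also have "\<dots> \<le> C * ?G ^ ?n * 1"
        using mult_right_mono[OF C0_le pos] by simp
      also have "\<dots> \<le> C * ?G ^ ?n * (?G * \<bar>s\<bar>) powr \<theta>"
        using True \<theta> pos C0_le C0(1) by (intro mult_left_mono) (auto simp: ge_one_powr_ge_zero)
      finally show ?thesis using G' by (simp add: mult.assoc)
    next
      case False
      have "\<bar>series_term q is (x + s *\<^sub>R axis t 1) - series_term q is (x + 0 *\<^sub>R axis t 1)\<bar>
          \<le> (D t * ?G ^ Suc ?n) * \<bar>s - 0\<bar>"
        using field_differentiable_bound[of UNIV "\<lambda>s. series_term q is (x + s *\<^sub>R axis t 1)"
            "\<lambda>s. series_term q (t # is) (x + s *\<^sub>R axis t 1)" "D t * ?G ^ Suc ?n" 0 s] line D(2)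
        by simp
      also have "\<dots> = D t * ?G ^ ?n * (?G * \<bar>s\<bar>)" by simp
      also have "\<dots> \<le> C * ?G ^ ?n * (?G * \<bar>s\<bar>)"
        using D_le G by (intro mult_right_mono) auto
      also have "\<dots> \<le> C * ?G ^ ?n * (?G * \<bar>s\<bar>) powr \<theta>"
      proof (rule mult_left_mono)
        have "(?G * \<bar>s\<bar>) powr 1 \<le> (?G * \<bar>s\<bar>) powr \<theta>"
          using False \<theta> G by (intro powr_mono') auto
        then show "?G * \<bar>s\<bar> \<le> (?G * \<bar>s\<bar>) powr \<theta>" using G by simp
        show "0 \<le> C * ?G ^ ?n" using pos C0_le C0(1) by simp
      qed
      finally show ?thesis using G' by (simp add: mult.assoc)
    qed
  qed
  then show ?thesis using that[of C] C0_le C0(1) by simp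
qed

lemma series_Hoelder:
  assumes "0 \<le> \<theta>" "\<theta> \<le> 1" "real (length is) + \<theta> < \<kappa>"
  obtains K where "\<And>x s t. \<bar>series is (x + s *\<^sub>R axis t 1) - series is x\<bar> \<le> K * \<bar>s\<bar> powr \<theta>"
proof -
  let ?w = "\<lambda>q. triadic_len q - triadic_len (Suc q)"
  obtain C where C: "\<And>q x s t. \<bar>series_term q is (x + s *\<^sub>R axis t 1) - series_term q is x\<bar>
      \<le> C * \<Gamma> q powr (real (length is) + \<theta>) * \<bar>s\<bar> powr \<theta>"
    using series_term_increment[of "is"] assms(1,2) by metis
  let ?M = "\<lambda>q. ?w q * (C * \<Gamma> q powr (real (length is) + \<theta>))"
  have M: "summable ?M" by (rule weighted_summable) (use assms in auto)
  have sm: "summable (\<lambda>q. ?w q * series_term q is x)" for x by (rule series_summable)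
      (use assms in simp)
  have "\<bar>series is (x + s *\<^sub>R axis t 1) - series is x\<bar> \<le> suminf ?M * \<bar>s\<bar> powr \<theta>" for x s t
  proof -
    have "series is (x + s *\<^sub>R axis t 1) - series is x = (\<Sum>q. ?w q * series_term q is (x
        + s *\<^sub>R axis t 1) - ?w q * series_term q is x)"
      unfolding series_def by (rule suminf_diff[OF sm sm])
    also have "norm \<dots> \<le> (\<Sum>q. ?M q * \<bar>s\<bar> powr \<theta>)"
    proof (rule norm_suminf_le)
      show "summable (\<lambda>q. ?M q * \<bar>s\<bar> powr \<theta>)" by (rule summable_mult2[OF M])
      fix q
      have "\<bar>?w q * series_term q is (x + s *\<^sub>R axis t 1) - ?w q * series_term q is x\<bar>
          = ?w q * \<bar>series_term q is (x + s *\<^sub>R axis t 1) - series_term q is x\<bar>"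
        using weight_pos[of q] by (simp add: right_diff_distrib[symmetric] abs_mult)
      also have "\<dots> \<le> ?w q * (C * \<Gamma> q powr (real (length is) + \<theta>) * \<bar>s\<bar> powr \<theta>)"
        using weight_pos[of q] C by (intro mult_left_mono) auto
      finally show "norm (?w q * series_term q is (x + s *\<^sub>R axis t 1) - ?w q * series_term q is x)
          \<le> ?M q * \<bar>s\<bar> powr \<theta>"
        by (simp only: real_norm_def mult.assoc)
    qed
    also have "\<dots> = suminf ?M * \<bar>s\<bar> powr \<theta>" by (rule suminf_mult2[OF M, symmetric])
    finally show ?thesis by simp
  qed
  then show ?thesis by (rule that)
qed

lemma series_term_Nil: "series_term q [] x = (\<Prod>i<q. stream_sign x i) * stream_digit x q"
proof -
  let ?h = "\<lambda>i. (if i < q then sign_fun (lev i) else digit_fun (lev i)) (local_coord (lev i) (x $ co i))"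
  have "series_term q [] x = (\<Prod>t\<in>UNIV. \<Prod>i\<in>{i. i \<le> q \<and> co i = t}. ?h i)"
    unfolding series_term_def factor_def by (auto intro!: prod.cong)
  also have "\<dots> = (\<Prod>t\<in>UNIV. \<Prod>i\<in>{i \<in> {..q}. co i = t}. ?h i)" by simp
  also have "\<dots> = prod ?h {..q}" by (rule prod.group) auto
  also have "{..q} = insert q {..<q}" by auto
  also have "prod ?h \<dots> = ?h q * prod ?h {..<q}" by simp
  also have "prod ?h {..<q} = (\<Prod>i<q. stream_sign x i)" unfolding stream_sign_def
      by (rule prod.cong) auto
  finally show ?thesis by (simp add: stream_digit_def mult.commute)
qed

lemma series_eq_signed_series:
    "series [] x = signed_series triadic_len (stream_digit x) (stream_sign x)"
  unfolding series_def signed_series_def series_term_Nil by (simp add: mult.commute)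

lemma stream_digits_ok: "digits_ok (stream_digit x) (stream_sign x)"
  by (rule digits_okI) (simp_all add: stream_digit_def stream_sign_def digit_sign_bounds)

text \<open>
  If no digit of coordinate \<open>t\<close> is in transition, every term is locally constant in that coordinate. The sum
  need not be, since the neighbourhoods shrink with \<open>q\<close>, but its derivative is the sum of the derivatives.
\<close>

lemma series_partial_flat:
  assumes "\<And>i. co i = t \<Longrightarrow> \<not> in_gap (lev i) (local_coord (lev i) (x $ t))"
  shows "series [t] x = 0"
proof -
  have flat: "deriv (factor q t) (x $ t) = 0" for q by (rule factor_deriv_flat[OF assms])
  have "series_term q [t] x = 0" for q
    unfolding series_term_def
  proof (rule prod_zero)
    show "\<exists>u\<in>UNIV. (deriv ^^ count_list [t] u) (factor q u) (x $ u) = 0"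
      using flat by (intro bexI[of _ t]) auto
  qed simp
  then show ?thesis by (simp add: series_def)
qed

text \<open>
  In contrast to the previous lemma, the terms do vary along the gap; their sum does not. The later
  digits in coordinate \<open>t\<close> are automatically \<open>c\<close>, since the local coordinates lie beyond the end \<open>c\<close>
  of the cells, so only the digits in the other coordinates have to be prescribed.
\<close>

lemma series_partial_across_gap:
  assumes \<kappa>: "1 < \<kappa>"
    and c: "\<bar>c\<bar> = 1" "cell_len (Suc s) < - c * local_coord s (x $ t)"
        "- c * local_coord s (x $ t) < cell_len s - 2 * cell_len (Suc s)"
    and tail: "\<And>n i. co n = t \<Longrightarrow> lev n = s \<Longrightarrow> i > n \<Longrightarrow> co i \<noteq> t
        \<Longrightarrow> stream_digit x i = c \<and> stream_sign x i = 1"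
    and mono: "\<And>i n. co i = t \<Longrightarrow> co n = t \<Longrightarrow> i > n \<Longrightarrow> lev i > lev n"
  shows "series [t] x = 0"
proof -
  let ?z = "\<lambda>h. x + h *\<^sub>R axis t 1"
  have zt: "?z h $ t = x $ t + h" "u \<noteq> t \<Longrightarrow> ?z h $ u = x $ u" for h u by (auto simp: axis_def)
  have gap: "in_gap s (local_coord s (x $ t))"
  proof -
    have "c = 1 \<or> c = -1" using c(1) by auto
    then show ?thesis using c cell_len_pos[of "Suc s"] by (auto simp: in_gap_def)
  qed
  have lim: "filterlim (\<lambda>h. x $ t + h) (nhds (x $ t)) (nhds 0)"
  proof -
    have "((\<lambda>h. x $ t + h) \<longlongrightarrow> x $ t + 0) (nhds 0)"
      by (rule tendsto_add[OF tendsto_const filterlim_ident])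
    then show ?thesis by simp
  qed
  have lim': "filterlim (\<lambda>h. local_coord r (x $ t + h)) (nhds (local_coord r (x $ t))) (nhds 0)" for r
  proof -
    have "filterlim (local_coord r) (nhds (local_coord r (x $ t))) (nhds (x $ t))"
      using isCont_local_coord[of "x $ t" r] by (simp add: isCont_def tendsto_at_iff_tendsto_nhds)
    from filterlim_compose[OF this lim] show ?thesis .
  qed
  have "\<forall>\<^sub>F z in nhds (local_coord s (x $ t)). cell_len (Suc s) < - c * z
      \<and> - c * z < cell_len s - 2 * cell_len (Suc s)"
  proof -
    have "open {z. cell_len (Suc s) < - c * z \<and> - c * z < cell_len s - 2 * cell_len (Suc s)}"
      by (intro open_Collect_conj open_Collect_less continuous_intros)
    from eventually_nhds_in_open[OF this, of "local_coord s (x $ t)"] c show ?thesis by simp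
  qed
  from eventually_compose_filterlim[OF this lim']
  have ev1: "\<forall>\<^sub>F h in nhds 0. cell_len (Suc s) < - c * local_coord s (x $ t + h)
      \<and> - c * local_coord s (x $ t + h) < cell_len s - 2 * cell_len (Suc s)" .
  have "\<forall>\<^sub>F h in nhds 0. digit_fun r (local_coord r (x $ t + h))
      = digit_fun r (local_coord r (x $ t)) \<and> sign_fun r (local_coord r (x $ t + h))
      = sign_fun r (local_coord r (x $ t))"
    if "r < s" for r
    by (rule eventually_compose_filterlim[OF digit_sign_locally_const lim'])
        (use in_gap_unique[OF gap] that in blast)
  then have "\<forall>\<^sub>F h in nhds 0. \<forall>r\<in>{..<s}. digit_fun r (local_coord r (x $ t + h))
      = digit_fun r (local_coord r (x $ t)) \<and> sign_fun r (local_coord r (x $ t + h))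
      = sign_fun r (local_coord r (x $ t))"
    by (intro eventually_ball_finite) auto
  with ev1 have "\<forall>\<^sub>F h in nhds 0. series [] (?z h) = series [] x"
  proof eventually_elim
    case (elim h)
    have past: "c * local_coord r (x $ t) > cell_len r" "c * local_coord r (x $ t + h) > cell_len r"
        if "r > s" for r
      using local_coord_past_gap[OF c that] local_coord_past_gap[OF c(1) _ _ that] elim(1) by blast+
    have far: "digit_fun r z = c \<and> sign_fun r z = 1" if "c * z > cell_len r" for r z
      by (rule digit_sign_far[OF c(1)]) (use that cell_len_pos[of "Suc r"] in linarith)
    have same: "stream_digit (?z h) i = stream_digit x i \<and> stream_sign (?z h) i = stream_sign x i"
        if "co i = t \<Longrightarrow> lev i \<noteq> s" for i
    proof (cases "co i = t")
      case False
      show ?thesis by (simp only: stream_digit_def stream_sign_def zt(2)[OF False])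
    next
      case True
      with that consider "lev i < s" | "lev i > s" by (metis linorder_neqE_nat)
      then show ?thesis
      proof cases
        case 1
        then show ?thesis using elim(2) True by (simp add: stream_digit_def stream_sign_def zt)
      next
        case 2
        then show ?thesis using far[OF past(1)[OF 2]] far[OF past(2)[OF 2]] True
            by (simp add: stream_digit_def stream_sign_def zt)
      qed
    qed
    show ?case
    proof (cases "\<exists>n. co n = t \<and> lev n = s")
      case False
      then have "stream_digit (?z h) = stream_digit x" "stream_sign (?z h) = stream_sign x"
          using same by auto
      then show ?thesis by (simp add: series_eq_signed_series)
    next
      case True
      then obtain n where n: "co n = t" "lev n = s" by blast
      have mid: "2 * digit_fun s z + c * sign_fun s z = - c" if "cell_len (Suc s) < - c * z" for z
      proof -
        have "\<bar>- c\<bar> = 1" "- c * z \<ge> 0" using c(1) that cell_len_pos[of "Suc s"] by auto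
        then show ?thesis unfolding digit_sign_side[OF \<open>\<bar>- c\<bar> = 1\<close> \<open>- c * z \<ge> 0\<close>]
            by (simp add: algebra_simps)
      qed
      have triadic_len: "triadic_len n - triadic_len (Suc n) = 2 * triadic_len (Suc n)"
          by (simp add: triadic_len_def)
      have "signed_series triadic_len (stream_digit x) (stream_sign x)
          = signed_series triadic_len (stream_digit (?z h)) (stream_sign (?z h))"
      proof (rule signed_series_switch[OF shrinking_triadic_len stream_digits_ok stream_digits_ok])
        show "stream_digit x i = stream_digit (?z h) i \<and> stream_sign x i = stream_sign (?z h) i" if
            "i \<noteq> n" for i
          using same[of i] inj_place[of i n] that n by metis
        show "stream_digit x i = c \<and> stream_sign x i = 1" if "i > n" for i
        proof (cases "co i = t")
          case True
          then have "lev i > s" using mono[OF True n(1) that] n(2) by simp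
          then show ?thesis using far[OF past(1)] True by (simp add: stream_digit_def stream_sign_def)
        next
          case False
          then show ?thesis using tail[OF n that] by simp
        qed
        have "stream_digit w n * (triadic_len n - triadic_len (Suc n))
            + stream_sign w n * c * triadic_len (Suc n) = - c * triadic_len (Suc n)"
          if "cell_len (Suc s) < - c * local_coord s (w $ t)" for w
        proof -
          have "stream_digit w n * (triadic_len n - triadic_len (Suc n))
              + stream_sign w n * c * triadic_len (Suc n)
             = (2 * stream_digit w n + c * stream_sign w n) * triadic_len (Suc n)"
                 unfolding triadic_len by (simp add: algebra_simps)
          then show ?thesis using mid[OF that] n by (simp add: stream_digit_def stream_sign_def)
        qed
        from this[of x] this[of "?z h"] c(2) elim(1)
        show "stream_digit x n * (triadic_len n - triadic_len (Suc n))
            + stream_sign x n * c * triadic_len (Suc n)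
          = stream_digit (?z h) n * (triadic_len n - triadic_len (Suc n))
              + stream_sign (?z h) n * c * triadic_len (Suc n)"
          by (simp only: zt)
      qed
      then show ?thesis by (simp add: series_eq_signed_series)
    qed
  qed
  then have "((\<lambda>h. series [] (?z h)) has_real_derivative 0) (at 0)"
    by (subst DERIV_cong_ev[OF refl _ refl, where g = "\<lambda>h. series [] x"]) auto
  moreover have "((\<lambda>h. series [] (?z h)) has_real_derivative series [t] x) (at 0)"
    using series_line_DERIV[of "[]" x t 0] \<kappa> by simp
  ultimately show ?thesis using DERIV_unique by metis
qed

end

section \<open>Growth of the derivatives\<close>

lemma inverse_gap_width: "1 / gap_width s = 3 ^ s * ((real s + 1) * (real s + 2))"
  by (simp add: gap_width_eq power_one_over field_simps)

lemma inverse_gap_width_mono: "s \<le> t \<Longrightarrow> 1 / gap_width s \<le> 1 / gap_width t"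
  unfolding inverse_gap_width by (intro mult_mono power_increasing) auto

lemma inverse_gap_width_ge_1: "1 \<le> 1 / gap_width s"
proof -
  have "1 * (1 * 1) \<le> (3::real) ^ s * ((real s + 1) * (real s + 2))" by (intro mult_mono) auto
  then show ?thesis by (simp add: inverse_gap_width)
qed

lemma inverse_gap_width_growth:
  assumes "\<delta> > 0"
  obtains C where "C > 0" "\<And>s. 1 / gap_width s \<le> C * 3 powr ((1 + \<delta>) * real s)"
proof -
  have "(\<lambda>s::nat. (real s + 1) * (real s + 2) / 3 powr (\<delta> * real s)) \<longlonglongrightarrow> 0"
    using assms by real_asymp
  then have "Bseq (\<lambda>s::nat. (real s + 1) * (real s + 2) / 3 powr (\<delta> * real s))"
    by (intro convergent_imp_Bseq convergentI)
  then obtain C where C: "C > 0" "\<And>s::nat. norm ((real s + 1) * (real s + 2) / 3 powr (\<delta> * real s)) \<le> C"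
    by (auto simp: Bseq_def)
  have "1 / gap_width s \<le> C * 3 powr ((1 + \<delta>) * real s)" for s
  proof -
    have "(real s + 1) * (real s + 2) / 3 powr (\<delta> * real s) \<le> C"
      using C(2)[of s] by (simp only: real_norm_def abs_le_iff)
    then have "(real s + 1) * (real s + 2) \<le> C * 3 powr (\<delta> * real s)"
      by (simp add: pos_divide_le_eq)
    then have "3 ^ s * ((real s + 1) * (real s + 2)) \<le> 3 ^ s * (C * 3 powr (\<delta> * real s))"
      by (intro mult_left_mono) auto
    also have "\<dots> = C * 3 powr ((1 + \<delta>) * real s)"
      by (simp add: powr_add distrib_right powr_realpow)
    finally show ?thesis by (simp only: inverse_gap_width)
  qed
  then show ?thesis using that C(1) by blast
qed

lemma triadic_len_powr: "triadic_len q = 3 powr (- real q)"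
  by (simp add: triadic_len_def powr_minus powr_realpow power_one_over inverse_eq_divide)

text \<open>
  The digit number \<open>q\<close> of the stream \<open>j, d + j, 2 d + j, \<dots>\<close> has level about \<open>q d / M\<close>. Up to a factor
  \<open>3\<^bsup>\<delta> s\<^esup>\<close> with arbitrarily small \<open>\<delta>\<close>, the derivatives of order \<open>\<theta>\<close> grow like \<open>3\<^bsup>\<theta> q d / M\<^esup>\<close>, which the
  weight \<open>3\<^sup>-\<^sup>q\<close> dominates exactly when \<open>\<theta> < M / d\<close>.
\<close>

lemma gap_weights_summable:
  fixes M d j :: nat
  assumes "M > 0" "d > 0" "0 \<le> \<theta>" "\<theta> < real M / real d"
  shows "summable (\<lambda>q. triadic_len q * (1 / gap_width ((q * d + j) div M)) powr \<theta>)"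
proof -
  define a where "a = \<theta> * real d / real M"
  have a: "0 \<le> a" "a < 1" using assms by (auto simp: a_def field_simps)
  \<comment> \<open>any \<open>\<delta> > 0\<close> with \<open>(1 + \<delta>) * a < 1\<close> serves; it absorbs the polynomial factor in the gap lengths\<close>
  define \<delta> where "\<delta> = (1 - a) / 2"
  have \<delta>: "\<delta> > 0" "(1 + \<delta>) * a < 1"
  proof -
    show "\<delta> > 0" using a by (simp add: \<delta>_def)
    have "0 < (1 - a) * (2 - a)" using a by simp
    then show "(1 + \<delta>) * a < 1" by (simp add: \<delta>_def field_simps)
  qed
  obtain C where C: "C > 0" "\<And>s. 1 / gap_width s \<le> C * 3 powr ((1 + \<delta>) * real s)"
    using inverse_gap_width_growth[OF \<delta>(1)] by blast
  define B where "B = C powr \<theta> * 3 powr ((1 + \<delta>) * \<theta> * real j / real M)"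
  define \<rho> :: real where "\<rho> = 3 powr ((1 + \<delta>) * a - 1)"
  have "\<rho> < 1" using \<delta>(2) by (simp add: \<rho>_def powr_less_one)
  then have "summable (\<lambda>q. B * \<rho> ^ q)" by (intro summable_mult summable_geometric) (simp add: \<rho>_def)
  moreover have "norm (triadic_len q * (1 / gap_width ((q * d + j) div M)) powr \<theta>) \<le> B * \<rho> ^ q" for q
  proof -
    define s where "s = (q * d + j) div M"
    have "real s \<le> real (q * d + j) / real M" 
    proof -
      have "real (s * M) \<le> real (q * d + j)" unfolding s_def of_nat_le_iff
          by (rule div_times_less_eq_dividend)
      then show ?thesis using assms(1) by (simp add: pos_le_divide_eq)
    qed
    then have s: "(1 + \<delta>) * real s \<le> (1 + \<delta>) * (real (q * d + j) / real M)"
      using \<delta>(1) by (intro mult_left_mono) auto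
    have "(1 / gap_width s) powr \<theta> \<le> (C * 3 powr ((1 + \<delta>) * real s)) powr \<theta>"
      using C(2) gap_width_pos[of s] assms(3) by (intro powr_mono2) auto
    also have "\<dots> \<le> (C * 3 powr ((1 + \<delta>) * (real (q * d + j) / real M))) powr \<theta>"
    proof -
      have "3 powr ((1 + \<delta>) * real s) \<le> (3::real) powr ((1 + \<delta>) * (real (q * d + j) / real M))"
        by (rule powr_mono[OF s]) simp
      then show ?thesis using C(1) assms(3) by (intro powr_mono2 mult_left_mono) auto
    qed
    also have "\<dots> = C powr \<theta> * 3 powr ((1 + \<delta>) * (real (q * d + j) / real M) * \<theta>)"
      using C(1) by (simp add: powr_mult powr_powr)
    also have "(1 + \<delta>) * (real (q * d + j) / real M) * \<theta> = (1 + \<delta>) * \<theta> * real j / real M + (1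
        + \<delta>) * a * real q"
      using assms(1) by (simp add: a_def field_simps)
    finally have "(1 / gap_width s) powr \<theta> \<le> B * 3 powr ((1 + \<delta>) * a * real q)"
      by (simp add: B_def powr_add mult.assoc)
    then have "triadic_len q * (1 / gap_width s) powr \<theta> \<le> triadic_len q * (B * 3 powr ((1
        + \<delta>) * a * real q))"
      by (intro mult_left_mono) (auto simp: triadic_len_def)
    also have "\<dots> = B * (3 powr (- real q) * 3 powr ((1 + \<delta>) * a * real q))"
      by (simp only: triadic_len_powr mult.left_commute)
    also have "3 powr (- real q) * 3 powr ((1 + \<delta>) * a * real q) = 3 powr (((1 + \<delta>) * a - 1) * real q)"
      by (simp only: powr_add[symmetric]) (simp add: algebra_simps)
    also have "\<dots> = \<rho> ^ q"
      by (simp add: \<rho>_def powr_powr[symmetric] powr_realpow)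
    finally have "triadic_len q * (1 / gap_width s) powr \<theta> \<le> B * \<rho> ^ q" .
    moreover have "triadic_len q * (1 / gap_width s) powr \<theta> \<ge> 0" by (simp add: triadic_len_def)
    ultimately show ?thesis by (simp add: s_def)
  qed
  ultimately show ?thesis by (rule summable_comparison_test')
qed

section \<open>Connectedness\<close>

text \<open>
  A separation into two closed sets cannot cut a segment, so both sets meet \<open>K\<close>. Their images are
  compact and cover the connected image of \<open>K\<close>, hence share a value, and the segment joining two
  points over that value would meet both sets.
\<close>

lemma connected_segments_over_fibres:
  fixes K :: "'a::euclidean_space set" and q :: "'a \<Rightarrow> 'b::t2_space"
  assumes K: "compact K" and q: "continuous_on K q" "connected (q ` K)"
  shows "connected (\<Union>{closed_segment x y | x y. x \<in> K \<and> y \<in> K \<and> q x = q y})"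
proof -
  define E where "E = \<Union>{closed_segment x y | x y. x \<in> K \<and> y \<in> K \<and> q x = q y}"
  have seg_E: "closed_segment x y \<subseteq> E" if "x \<in> K" "y \<in> K" "q x = q y" for x y
    unfolding E_def using that by blast
  have E_seg: "\<exists>x y. x \<in> K \<and> y \<in> K \<and> q x = q y \<and> z \<in> closed_segment x y" if "z \<in> E" for z
    using that unfolding E_def by blast
  have KE: "K \<subseteq> E"
  proof
    fix x assume "x \<in> K"
    then have "closed_segment x x \<subseteq> E" by (intro seg_E) auto
    then show "x \<in> E" by simp
  qed
  have "\<not> (\<exists>A B. closed A \<and> closed B \<and> E \<subseteq> A \<union> B \<and> A \<inter> B \<inter> E = {} \<and> A \<inter> E \<noteq> {} \<and> B \<inter> E \<noteq> {})"
  proof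
    assume "\<exists>A B. closed A \<and> closed B \<and> E \<subseteq> A \<union> B \<and> A \<inter> B \<inter> E = {} \<and> A \<inter> E \<noteq> {} \<and> B \<inter> E \<noteq> {}"
    then obtain A B where AB: "closed A" "closed B" "E \<subseteq> A \<union> B" "A \<inter> B \<inter> E = {}" "A \<inter> E \<noteq> {}"
        "B \<inter> E \<noteq> {}"
      by blast
    (* a segment joining two points of one fibre stays on one side of the separation *)
    have one_side: "closed_segment x y \<inter> A = {} \<or> closed_segment x y \<inter> B = {}" if "x \<in> K" "y \<in> K"
        "q x = q y" for x y
    proof -
      have sub: "closed_segment x y \<subseteq> E" by (rule seg_E[OF that])
      have "closed_segment x y \<subseteq> A \<union> B" using sub AB(3) by (rule order_trans)
      moreover have "A \<inter> B \<inter> closed_segment x y = {}" using sub AB(4) by auto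
      ultimately show ?thesis
        using connected_closedD[OF connected_segment, of A B x y] AB(1,2) by (auto simp: Int_commute)
    qed
    have meets: "K \<inter> S \<noteq> {}"
      if S: "S \<inter> E \<noteq> {}" "E \<subseteq> S \<union> T"
        and side: "\<And>x y. x \<in> K \<Longrightarrow> y \<in> K \<Longrightarrow> q x = q y
            \<Longrightarrow> closed_segment x y \<inter> S = {} \<or> closed_segment x y \<inter> T = {}"
      for S T
    proof -
      obtain z where z: "z \<in> S" "z \<in> E" using S(1) by blast
      obtain x y where xy: "x \<in> K" "y \<in> K" "q x = q y" "z \<in> closed_segment x y" using E_seg[OF z(2)]
          by blast
      have "closed_segment x y \<inter> T = {}" using side[OF xy(1-3)] xy(4) z(1) by auto
      then have "x \<notin> T" using ends_in_segment(1)[of x y] by auto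
      moreover have "x \<in> E" using KE xy(1) by (rule subsetD)
      ultimately have "x \<in> S" using S(2) by auto
      then show ?thesis using xy(1) by auto
    qed
    have "K \<inter> A \<noteq> {}" by (rule meets[OF AB(5,3) one_side])
    moreover have "K \<inter> B \<noteq> {}"
    proof (rule meets[OF AB(6)])
      show "E \<subseteq> B \<union> A" using AB(3) by (simp only: Un_commute)
      show "closed_segment x y \<inter> B = {} \<or> closed_segment x y \<inter> A = {}" if "x \<in> K" "y \<in> K"
          "q x = q y" for x y
        using one_side[OF that] by (rule disj_commute[THEN iffD1])
    qed
    moreover have "closed (q ` (K \<inter> S))" if "closed S" for S
    proof -
      have "continuous_on (K \<inter> S) q" using q(1) by (rule continuous_on_subset) simp
      moreover have "compact (K \<inter> S)" using K that by (rule compact_Int_closed)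
      ultimately show ?thesis by (intro compact_imp_closed compact_continuous_image)
    qed
    moreover have "q ` K \<subseteq> q ` (K \<inter> A) \<union> q ` (K \<inter> B)" using order_trans[OF KE AB(3)] by auto
    ultimately have "q ` (K \<inter> A) \<inter> q ` (K \<inter> B) \<inter> q ` K \<noteq> {}"
      using connected_closedD[OF q(2), of "q ` (K \<inter> A)" "q ` (K \<inter> B)"] AB(1,2)
          by (auto simp: image_Int_subset)
    then obtain v where v: "v \<in> q ` (K \<inter> A)" "v \<in> q ` (K \<inter> B)" by auto
    obtain x where x: "x \<in> K" "x \<in> A" "q x = v" using v(1) by auto
    obtain y where y: "y \<in> K" "y \<in> B" "q y = v" using v(2) by auto
    have "closed_segment x y \<inter> A = {} \<or> closed_segment x y \<inter> B = {}"
      by (rule one_side) (simp_all add: x y)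
    then show False using x(2) y(2) ends_in_segment[of x y] by auto
  qed
  then show ?thesis unfolding connected_closed E_def .
qed

section \<open>Classes of real order\<close>

text \<open>
  A function that satisfies a Hoelder condition of an exponent larger than \<open>l\<close> has \<open>l\<close>-partial derivatives
  equal to zero, so only the derivatives of integer order have to be exhibited. The strict inequality
  \<open>k < \<kappa>\<close> leaves room for a larger exponent.
\<close>

lemma real_class_of_derivative_family:
  fixes D :: "'m::finite list \<Rightarrow> real^'m \<Rightarrow> real^'n"
  assumes deriv: "\<And>is x. real (length is) + 1 < \<kappa> \<Longrightarrow>
      (D is has_derivative (\<lambda>h. \<Sum>t\<in>UNIV. h $ t *\<^sub>R D (t # is) x)) (at x)"
    and cont: "\<And>is. real (length is) < \<kappa> \<Longrightarrow> continuous_on UNIV (D is)"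
    and Hoelder: "\<And>is \<theta>. 0 \<le> \<theta> \<Longrightarrow> \<theta> \<le> 1 \<Longrightarrow> real (length is) + \<theta> < \<kappa> \<Longrightarrow>
      \<exists>C. \<forall>x s t. \<bar>s\<bar> \<le> 1 \<longrightarrow> norm (D is (x + s *\<^sub>R axis t 1) - D is x) \<le> C * \<bar>s\<bar> powr \<theta>"
    and k: "0 \<le> k" "k < \<kappa>"
  shows "real_class k (D [])"
proof -
  have line: "((\<lambda>s. D is (x + s *\<^sub>R axis i 1)) has_vector_derivative D (i # is) x) (at 0)"
    if "real (length is) + 1 < \<kappa>" for "is" i x
    using axis_line_vector_derivative[of "D is" "\<lambda>u. D (u # is) x" x 0 i] deriv[OF that] by simp
  have iter: "iter_partial is (D []) = D is" if "real (length is) < \<kappa>" for "is"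
    using that
  proof (induction "is")
    case (Cons i "is")
    then have "real (length is) + 1 < \<kappa>" by simp
    then have "partial i (D is) = D (i # is)"
      unfolding partial_def by (intro ext vector_derivative_at line)
    then show ?case using Cons by simp
  qed simp
  define j where "j = nat \<lfloor>k\<rfloor>"
  have j: "real j \<le> k" "real j < \<kappa>" "k - of_int \<lfloor>k\<rfloor> = k - real j" "k - real j < 1"
    using k unfolding j_def by linarith+
  have "nat_class j (D [])"
    unfolding nat_class_def
  proof (intro conjI allI impI)
    fix "is" :: "'m list" and i a
    assume "length is < j"
    then have "real (length is) + 1 \<le> real j" by simp
    then have "real (length is) + 1 < \<kappa>" "real (length is) < \<kappa>" using j(2) by linarith+
    then show "\<exists>d. has_partial i (iter_partial is (D [])) d a"
      unfolding has_partial_def using line iter by auto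
  next
    fix "is" :: "'m list"
    assume "length is \<le> j"
    then have "real (length is) < \<kappa>" using j(2) by linarith
    then show "continuous_on UNIV (iter_partial is (D []))" using cont iter by simp
  qed
  moreover have "frac_class (k - real j) (iter_partial is (D []))" if length_is: "length is = j" for
      "is"
  proof -
    have it: "iter_partial is (D []) = D is" using iter length_is j(2) by simp
    show ?thesis
    proof (cases "k - real j = 0")
      case True
      then show ?thesis using cont[of "is"] length_is j(2) by (simp add: frac_class_def it)
    next
      case False
      define l where "l = k - real j"
      have l: "0 < l" "l < 1" "l < \<kappa> - real j" using False j k by (auto simp: l_def)
      \<comment> \<open>an exponent strictly between \<open>l\<close> and \<open>\<kappa> - j\<close>, capped at 1\<close>
      define \<theta> where "\<theta> = min 1 ((l + (\<kappa> - real j)) / 2)"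
      have \<theta>: "l < \<theta>" "\<theta> \<le> 1" "real j + \<theta> < \<kappa>"
      proof -
        have "l < (l + (\<kappa> - real j)) / 2" "(l + (\<kappa> - real j)) / 2 < \<kappa> - real j"
          using l by (simp_all add: field_simps)
        moreover have "\<theta> \<le> (l + (\<kappa> - real j)) / 2" unfolding \<theta>_def by (rule min.cobounded2)
        ultimately show "l < \<theta>" "\<theta> \<le> 1" "real j + \<theta> < \<kappa>" using l(2)
            by (simp add: \<theta>_def, simp add: \<theta>_def, linarith)
      qed
      obtain C where C: "\<And>x s t. \<bar>s\<bar> \<le> 1 \<Longrightarrow> norm (D is (x + s *\<^sub>R axis t 1) - D is x) \<le> C * \<bar>s\<bar> powr \<theta>"
        using Hoelder[of \<theta> "is"] \<theta> l length_is by auto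
      have "has_frac_partial l i (D is) 0 a" for i a
        unfolding has_frac_partial_def
      proof (rule Lim_null_comparison)
        have "((\<lambda>s::real. \<bar>s\<bar> powr (\<theta> - l)) \<longlongrightarrow> 0 powr (\<theta> - l)) (at 0)"
          by (rule tendsto_powr2) (use \<theta>(1) in \<open>auto intro!: tendsto_eq_intros\<close>)
        then show "((\<lambda>s. C * \<bar>s\<bar> powr (\<theta> - l)) \<longlongrightarrow> 0) (at 0)"
          by (auto intro: tendsto_mult_right_zero)
        have "\<forall>\<^sub>F s::real in at 0. s \<noteq> 0 \<and> \<bar>s\<bar> \<le> 1"
          by (auto simp: eventually_at intro!: exI[of _ 1])
        then show "\<forall>\<^sub>F s in at 0. norm ((sgn s / \<bar>s\<bar> powr l) *\<^sub>R (D is (a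
            + s *\<^sub>R axis i 1) - D is a)) \<le> C * \<bar>s\<bar> powr (\<theta> - l)"
        proof eventually_elim
          case (elim s)
          have "norm ((sgn s / \<bar>s\<bar> powr l) *\<^sub>R (D is (a + s *\<^sub>R axis i 1) - D is a)) =
              norm (D is (a + s *\<^sub>R axis i 1) - D is a) / \<bar>s\<bar> powr l"
            using elim by (simp add: abs_mult abs_sgn_eq)
          also have "\<dots> \<le> C * \<bar>s\<bar> powr \<theta> / \<bar>s\<bar> powr l"
            using C[of s a i] elim by (intro divide_right_mono) auto
          also have "\<dots> = C * \<bar>s\<bar> powr (\<theta> - l)" by (simp add: powr_diff)
          finally show ?case .
        qed
      qed
      then have "\<forall>i. \<exists>g. continuous_on UNIV g \<and> (\<forall>a. has_frac_partial l i (D is) (g a) a)"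
        by (intro allI exI[of _ "\<lambda>a. 0"]) auto
      then show ?thesis using False unfolding frac_class_def it l_def by simp
    qed
  qed
  ultimately show ?thesis unfolding real_class_def j(3) j_def[symmetric] by blast
qed

section \<open>The critical set\<close>

text \<open>
  The coordinates \<open>\<tau> 0, \<dots>, \<tau> (M - 1)\<close> carry the digits; the others are free. The digits of all coordinates
  are merged into one sequence, in which the coordinates take turns.
\<close>

locale digit_layout =
  fixes \<tau> :: "nat \<Rightarrow> 'm::finite" and M :: nat
  assumes M_pos: "M > 0" and inj_\<tau>: "inj_on \<tau> {..<M}"
begin

definition place :: "nat \<Rightarrow> 'm" where "place N = \<tau> (N mod M)"
definition level :: "nat \<Rightarrow> nat" where "level N = N div M"
definition digit :: "real^'m \<Rightarrow> nat \<Rightarrow> real" where "digit x N = cantor_digit (x $ place N) (level N)"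

text \<open>
  The numbers with index \<open>j\<close> modulo \<open>d\<close> are the digits of target coordinate \<open>j\<close>. The case \<open>d = 1\<close> reads the whole
  sequence as a single number; its fibres decide which points are joined by segments.
\<close>

definition readout :: "nat \<Rightarrow> nat \<Rightarrow> 'm list \<Rightarrow> real^'m \<Rightarrow> real" where
  "readout d j = digit_stream.series (\<lambda>i. place (i * d + j)) (\<lambda>i. level (i * d + j))"

lemma place_level_inj: "place N = place N' \<Longrightarrow> level N = level N' \<Longrightarrow> N = N'"
proof -
  assume *: "place N = place N'" "level N = level N'"
  have "N mod M = N' mod M" using *(1) inj_onD[OF inj_\<tau>, of "N mod M" "N' mod M"] M_pos
      by (simp add: place_def)
  with *(2) show "N = N'" unfolding level_def by (metis div_mult_mod_eq)
qed

lemma place_level_mono: "place N = place N' \<Longrightarrow> N < N' \<Longrightarrow> level N < level N'"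
  using place_level_inj[of N N'] div_le_mono[of N N' M] unfolding level_def by fastforce

lemma place_level_at: "i < M \<Longrightarrow> place (s * M + i) = \<tau> i \<and> level (s * M + i) = s"
  by (simp add: place_def level_def)

lemma place_range: "place N \<in> \<tau> ` {..<M}" using M_pos by (simp add: place_def)

lemma stream:
  assumes "d > 0"
  shows "digit_stream (\<lambda>i. place (i * d + j)) (\<lambda>i. level (i * d + j)) (\<lambda>q. 1 / gap_width ((q * d
      + j) div M)) (real M / real d)"
proof
  show "i = k" if "place (i * d + j) = place (k * d + j)" "level (i * d + j) = level (k * d + j)"
      for i k
    using place_level_inj[OF that] assms by simp
  show "1 / gap_width (level (i * d + j)) \<le> 1 / gap_width ((q * d + j) div M)" if "i \<le> q" for i q
    unfolding level_def using that by (intro inverse_gap_width_mono div_le_mono) simp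
  show "1 \<le> 1 / gap_width ((q * d + j) div M)" for q by (rule inverse_gap_width_ge_1)
  show "summable (\<lambda>q. triadic_len q * (1 / gap_width ((q * d + j) div M)) powr \<theta>)" if "0 \<le> \<theta>"
      "\<theta> < real M / real d" for \<theta>
    by (rule gap_weights_summable[OF M_pos assms that])
qed

definition cantor_product :: "(real^'m) set" where
  "cantor_product = {x. (\<forall>t\<in>\<tau> ` {..<M}. x $ t \<in> cantor) \<and> (\<forall>t. t \<notin> \<tau> ` {..<M} \<longrightarrow> x $ t \<in> {-1..1})}"

definition critical_set :: "(real^'m) set" where
  "critical_set = \<Union>{closed_segment x y | x y. x \<in> cantor_product \<and> y \<in> cantor_product
      \<and> readout 1 0 [] x = readout 1 0 [] y}"

lemma cantor_product_subset: "cantor_product \<subseteq> critical_set"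
proof
  fix x assume "x \<in> cantor_product"
  then have "closed_segment x x \<in> {closed_segment x y | x y. x \<in> cantor_product \<and> y \<in> cantor_product
      \<and> readout 1 0 [] x = readout 1 0 [] y}"
    by blast
  then show "x \<in> critical_set" unfolding critical_set_def by auto
qed

lemma compact_cantor_product: "compact cantor_product"
proof -
  define S where "S t = (if t \<in> \<tau> ` {..<M} then cantor else {-1..1})" for t
  have cantor_product: "cantor_product = (\<Inter>t. {x. x $ t \<in> S t})" 
  proof (intro set_eqI iffI)
    fix x assume "x \<in> cantor_product"
    then have x: "\<forall>t\<in>\<tau> ` {..<M}. x $ t \<in> cantor" "\<forall>t. t \<notin> \<tau> ` {..<M} \<longrightarrow> x $ t \<in> {-1..1}"
      unfolding cantor_product_def by blast+
    have "x $ t \<in> S t" for t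
    proof (cases "t \<in> \<tau> ` {..<M}")
      case True
      then show ?thesis using bspec[OF x(1) True] by (simp only: S_def if_True)
    next
      case False
      then show ?thesis using x(2) by (simp only: S_def if_False) blast
    qed
    then show "x \<in> (\<Inter>t. {x. x $ t \<in> S t})" by simp
  next
    fix x assume "x \<in> (\<Inter>t. {x. x $ t \<in> S t})"
    then have S: "x $ t \<in> S t" for t by simp
    have "x $ t \<in> cantor" if "t \<in> \<tau> ` {..<M}" for t using S[of t] that by (simp only: S_def if_True)
    moreover have "x $ t \<in> {-1..1}" if "t \<notin> \<tau> ` {..<M}" for t using S[of t] that
        by (simp only: S_def if_False)
    ultimately show "x \<in> cantor_product" unfolding cantor_product_def by blast
  qed
  have "closed {x :: real^'m. x $ t \<in> S t}" for t
  proof -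
    have "closed (S t)" by (simp add: S_def closed_cantor)
    from continuous_closed_vimage[OF this, of "\<lambda>x::real^'m. x $ t"] show ?thesis
      by (simp add: vimage_def continuous_component)
  qed
  then have "closed cantor_product" unfolding cantor_product by (intro closed_INT ballI) auto
  moreover have "cantor_product \<subseteq> cbox (\<chi> t. -2) (\<chi> t. 2)"
  proof
    fix x assume "x \<in> cantor_product"
    then have "x $ t \<in> S t" for t unfolding cantor_product by blast
    moreover have "S t \<subseteq> {-2..2}" for t using cantor_subset by (auto simp: S_def)
    ultimately have "x $ t \<in> {-2..2}" for t by blast
    then show "x \<in> cbox (\<chi> t. -2) (\<chi> t. 2)" by (auto simp: mem_box_cart)
  qed
  then have "bounded cantor_product" using bounded_cbox bounded_subset by blast
  ultimately show ?thesis by (simp add: compact_eq_bounded_closed)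
qed

lemma cantor_product_place: "x \<in> cantor_product \<Longrightarrow> x $ place N \<in> cantor"
  unfolding cantor_product_def using place_range by blast

lemma trit_digit: "x \<in> cantor_product \<Longrightarrow> trit (digit x N)"
  unfolding digit_def by (rule cantor_digits(1)[OF cantor_product_place])

lemma readout_cantor_product:
  assumes "x \<in> cantor_product" "d > 0"
  shows "readout d j [] x = mirrored_value triadic_len (\<lambda>i. digit x (i * d + j))"
proof -
  interpret digit_stream "\<lambda>i. place (i * d + j)" "\<lambda>i. level (i * d + j)"
      "\<lambda>q. 1 / gap_width ((q * d + j) div M)" "real M / real d"
    by (rule stream[OF assms(2)])
  have "stream_digit x = (\<lambda>i. digit x (i * d + j))"
      by (auto simp: stream_digit_def digit_def cantor_digit_def)
  moreover have "stream_sign x = (\<lambda>i. orientation (digit x (i * d + j)))"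
    unfolding stream_sign_def digit_def
        by (rule ext) (rule cantor_digits(2)[OF cantor_product_place[OF assms(1)]])
  ultimately show ?thesis by (simp add: readout_def series_eq_signed_series)
qed

lemma cantor_product_with_digits:
  assumes "\<And>N. trit (e N)" "\<And>t. t \<notin> \<tau> ` {..<M} \<Longrightarrow> w t \<in> {-1..1}"
  obtains x where "x \<in> cantor_product" "\<And>N. digit x N = e N" "\<And>t. t \<notin> \<tau> ` {..<M} \<Longrightarrow> x $ t = w t"
proof -
  have "\<forall>i. \<exists>y. y \<in> cantor \<and> (\<forall>s. cantor_digit y s = e (s * M + i))"
  proof
    fix i show "\<exists>y. y \<in> cantor \<and> (\<forall>s. cantor_digit y s = e (s * M + i))"
      by (rule cantor_exists[of "\<lambda>s. e (s * M + i)"]) (use assms(1) in auto)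
  qed
  then obtain Y where Y: "\<And>i. Y i \<in> cantor" "\<And>i s. cantor_digit (Y i) s = e (s * M + i)" by metis
  define x :: "real^'m" where "x = (\<chi> t. if t \<in> \<tau> ` {..<M} then Y (inv_into {..<M} \<tau> t) else w t)"
  have x: "x $ \<tau> i = Y i" if "i < M" for i using that inj_\<tau> by (simp add: x_def)
  show ?thesis
  proof (rule that[of x])
    show "x \<in> cantor_product" using Y(1) assms(2) by (auto simp: cantor_product_def x_def)
    show "digit x N = e N" for N
      using x[of "N mod M"] Y(2) M_pos by (simp add: digit_def place_def level_def)
    show "x $ t = w t" if "t \<notin> \<tau> ` {..<M}" for t using that by (simp add: x_def)
  qed
qed

lemma readout_image: "readout 1 0 [] ` cantor_product = {-1..1}"
proof
  show "readout 1 0 [] ` cantor_product \<subseteq> {-1..1}"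
  proof
    fix v assume "v \<in> readout 1 0 [] ` cantor_product"
    then obtain x where x: "x \<in> cantor_product" "v = readout 1 0 [] x" by blast
    have "\<bar>v\<bar> \<le> triadic_len 0" unfolding x(2) readout_cantor_product[OF x(1) zero_less_one]
      by (rule signed_series_bound[OF shrinking_triadic_len trit_digits_ok])
          (use trit_digit[OF x(1)] in auto)
    then show "v \<in> {-1..1}" by (auto simp: triadic_len_def abs_le_iff)
  qed
  show "{-1..1} \<subseteq> readout 1 0 [] ` cantor_product"
  proof
    fix v :: real assume "v \<in> {-1..1}"
    then obtain e where e: "\<And>i. trit (e i)" "mirrored_value triadic_len e = v"
        using trit_expansion[of v] by (auto simp: abs_le_iff)
    obtain x where x: "x \<in> cantor_product" "\<And>N. digit x N = e N"
      by (rule cantor_product_with_digits[of e "\<lambda>t. 0"]) (use e in auto)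
    have "readout 1 0 [] x = v" using readout_cantor_product[OF x(1) zero_less_one, of 0] x(2) e(2)
        by simp
    then show "v \<in> readout 1 0 [] ` cantor_product" using x(1) by blast
  qed
qed

lemma connected_critical_set: "connected critical_set"
  unfolding critical_set_def
proof (rule connected_segments_over_fibres[OF compact_cantor_product])
  interpret digit_stream "\<lambda>i. place (i * 1 + 0)" "\<lambda>i. level (i * 1 + 0)"
      "\<lambda>q. 1 / gap_width ((q * 1 + 0) div M)" "real M / real 1"
    by (rule stream) simp
  have "continuous_on UNIV (readout 1 0 [])"
    unfolding readout_def by (rule series_continuous) (use M_pos in simp)
  then show "continuous_on cantor_product (readout 1 0 [])" by (rule continuous_on_subset) simp
  show "connected (readout 1 0 [] ` cantor_product)" unfolding readout_image by simp
qed

text \<open>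
  The end points of the segment have equal readouts. Either they agree in all coordinates with digits,
  and the segment moves only free coordinates, or they face each other across a gap in one coordinate and
  share the digit \<open>c\<close> at all later places.
\<close>

lemma readout_partial_critical:
  assumes z: "z \<in> critical_set" and d: "0 < d" "d < M"
  shows "readout d j [t] z = 0"
proof -
  interpret digit_stream "\<lambda>i. place (i * d + j)" "\<lambda>i. level (i * d + j)"
      "\<lambda>q. 1 / gap_width ((q * d + j) div M)" "real M / real d"
    by (rule stream[OF d(1)])
  have \<kappa>: "1 < real M / real d" using d by simp
  have flat: "readout d j [t] z = 0" if "t \<in> \<tau> ` {..<M} \<Longrightarrow> z $ t \<in> cantor"
    unfolding readout_def
  proof (rule series_partial_flat)
    fix i assume "place (i * d + j) = t"
    then have "z $ t \<in> cantor" using that place_range by metis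
    then show "\<not> in_gap (level (i * d + j)) (local_coord (level (i * d + j)) (z $ t))"
        by (simp add: cantor_def)
  qed
  obtain x y u where xy: "x \<in> cantor_product" "y \<in> cantor_product" "readout 1 0 [] x = readout 1 0 [] y"
    and u: "0 \<le> u" "u \<le> 1" "z = (1 - u) *\<^sub>R x + u *\<^sub>R y"
    using z unfolding critical_set_def closed_segment_def by blast
  have zt: "z $ r = (1 - u) * x $ r + u * y $ r" for r by (simp add: u(3))
  have range_cantor: "x $ r \<in> cantor" "y $ r \<in> cantor" if "r \<in> \<tau> ` {..<M}" for r using xy that
      by (auto simp: cantor_product_def)
  have same: "x $ r = z $ r \<and> y $ r = z $ r" 
    if r: "r \<in> \<tau> ` {..<M}" "\<And>N. place N = r \<Longrightarrow> digit x N = digit y N" for r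
  proof -
    obtain i where i: "i < M" "r = \<tau> i" using r(1) by blast
    have "x $ r = y $ r"
    proof (rule cantor_inj[OF range_cantor[OF r(1)]])
      show "cantor_digit (x $ r) s = cantor_digit (y $ r) s" for s
        using r(2)[of "s * M + i"] place_level_at[OF i(1), of s] i(2) by (simp add: digit_def)
    qed
    then show ?thesis using zt[of r] by (simp add: algebra_simps)
  qed
  have eq: "mirrored_value triadic_len (digit x) = mirrored_value triadic_len (digit y)"
    using xy readout_cantor_product[of _ 1 0] by simp
  show ?thesis
  proof (cases "digit x = digit y")
    case True
    show ?thesis
    proof (rule flat)
      assume "t \<in> \<tau> ` {..<M}"
      then show "z $ t \<in> cantor" using same[of t] True range_cantor[of t] by simp
    qed
  next
    case False
    obtain n c where c: "\<bar>c\<bar> = 1" "\<And>N. N < n \<Longrightarrow> digit x N = digit y N"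
        "{digit x n, digit y n} = {0, - c}"
        "\<And>N. N > n \<Longrightarrow> digit x N = c \<and> digit y N = c"
      using mirrored_value_triadic_len_ambiguous[OF trit_digit[OF xy(1)] trit_digit[OF xy(2)] eq False] by metis
    have others: "x $ r = z $ r \<and> y $ r = z $ r" if "r \<in> \<tau> ` {..<M}" "r \<noteq> place n" for r
    proof (rule same[OF that(1)])
      fix N assume "place N = r"
      then have "N \<noteq> n" using that(2) by blast
      then show "digit x N = digit y N" using c(2)[of N] c(4)[of N] by (cases "N < n") auto
    qed
    show ?thesis
    proof (cases "t \<in> \<tau> ` {..<M} \<longrightarrow> z $ t \<in> cantor")
      case True
      then show ?thesis using flat by blast
    next
      case False
      then have t: "t \<in> \<tau> ` {..<M}" "z $ t \<notin> cantor" by auto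
      then have tn: "t = place n" using others[of t] range_cantor[of t] by metis
      have "u \<noteq> 0" "u \<noteq> 1" using t(2) zt[of t] range_cantor[OF t(1)] by auto
      then have u': "0 < u" "u < 1" using u(1,2) by auto
      define i where "i = n mod M"
      have i: "i < M" "t = \<tau> i" "n = level n * M + i" using M_pos tn
          by (auto simp: i_def place_def level_def)
      have dg: "cantor_digit (v $ t) s = digit v (s * M + i)" for v s
        using place_level_at[OF i(1), of s] i(2) by (simp add: digit_def)
      have before: "cantor_digit (x $ t) s = cantor_digit (y $ t) s" if "s < level n" for s
      proof -
        have "s * M < level n * M" using that M_pos by simp
        then have "s * M + i < n" using i(3) by linarith
        then show ?thesis unfolding dg by (rule c(2))
      qed
      have at: "{cantor_digit (x $ t) (level n), cantor_digit (y $ t) (level n)} = {0, - c}"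
        unfolding dg i(3)[symmetric] by (rule c(3))
      have after: "cantor_digit (x $ t) s = c \<and> cantor_digit (y $ t) s = c" if "s > level n" for s
      proof -
        have "level n * M < s * M" using that M_pos by simp
        then have "s * M + i > n" using i(3) by linarith
        then show ?thesis unfolding dg by (rule c(4))
      qed
      have gap1: "cell_len (Suc (level n)) < - c * local_coord (level n) (z $ t)"
        unfolding zt[of t]
        by (rule gap_crossing(1)[OF range_cantor[OF t(1)] _ c(1) at _ u']) (simp_all add: before after)
      have gap2: "- c * local_coord (level n) (z $ t) < cell_len (level n) - 2 * cell_len (Suc (level n))"
        unfolding zt[of t]
        by (rule gap_crossing(2)[OF range_cantor[OF t(1)] _ c(1) at _ u']) (simp_all add: before after)
      show ?thesis
        unfolding readout_def
      proof (rule series_partial_across_gap[OF \<kappa> c(1) gap1 gap2])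
        show "stream_digit z k = c \<and> stream_sign z k = 1"
          if "place (l * d + j) = t" "level (l * d + j) = level n" "l < k" "place (k * d + j) \<noteq> t"
              for l k
        proof -
          have "l * d + j = n" by (rule place_level_inj) (simp_all only: that(1,2) tn)
          moreover have "l * d < k * d" using that(3) d(1) by simp
          ultimately have "k * d + j > n" by linarith
          then have "digit x (k * d + j) = c" using c(4) by blast
          moreover have xz: "x $ place (k * d + j) = z $ place (k * d + j)"
            using others[OF place_range[of "k * d + j"]] that(4) by (simp only: tn not_False_eq_True)
          ultimately have dig_c: "cantor_digit (z $ place (k * d + j)) (level (k * d + j)) = c"
              by (simp only: digit_def)
          have "z $ place (k * d + j) \<in> cantor"
            using range_cantor(1)[OF place_range[of "k * d + j"]] by (simp only: xz)
          from cantor_digits(2)[OF this, of "level (k * d + j)"] dig_c c(1)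
          show ?thesis by (simp only: stream_digit_def stream_sign_def cantor_digit_def) (simp add: orientation_def)
        qed
        show "level (l * d + j) < level (k * d + j)" if "place (k * d + j) = t"
            "place (l * d + j) = t" "l < k" for k l
        proof (rule place_level_mono)
          show "place (l * d + j) = place (k * d + j)" by (simp only: that(1,2))
          show "l * d + j < k * d + j" using that(3) d(1) by simp
        qed
      qed
    qed
  qed
qed

end

section \<open>Assembling the map\<close>

text \<open>
  The range is the coordinate subspace belonging to \<open>R\<close>.
\<close>

lemma rank_coordinate_projection:
  fixes \<pi> :: "'n::finite \<Rightarrow> 'm::finite"
  assumes "inj_on \<pi> R"
  shows "rank (matrix (\<lambda>h::real^'m. \<chi> j. if j \<in> R then h $ \<pi> j else 0) :: real^'m^'n) = card R"
proof -
  let ?f = "\<lambda>h::real^'m. (\<chi> j. if j \<in> R then h $ \<pi> j else 0) :: real^'n"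
  have lin: "linear ?f" by (intro linearI) (auto simp: vec_eq_iff)
  have "range ?f = {v :: real^'n. \<forall>j. j \<notin> R \<longrightarrow> v $ j = 0}"
  proof (intro equalityI subsetI)
    fix v :: "real^'n" assume v: "v \<in> {v. \<forall>j. j \<notin> R \<longrightarrow> v $ j = 0}"
    have "v = ?f (\<chi> i. v $ inv_into R \<pi> i)"
      using v assms by (auto simp: vec_eq_iff)
    then show "v \<in> range ?f" by blast
  qed auto
  moreover have "dim {v :: real^'n. \<forall>j. j \<notin> R \<longrightarrow> v $ j = 0} = card R"
    by (simp add: dim_substandard_cart dim_vec_eq[symmetric])
  moreover have "(*v) (matrix ?f) = ?f" using matrix_vector_mul(2)[OF lin] by simp
  ultimately show ?thesis by (simp add: rank_dim_range)
qed

theorem theorem2: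
  fixes r :: nat
  assumes "CARD('m::finite) > CARD('n::finite)" and "CARD('n) > r"
  shows "\<exists>(p :: real^'m \<Rightarrow> real^'n) E.
           (\<forall>k::real. 0 \<le> k \<and> k < (real CARD('m) - real r) / (real CARD('n) - real r)
              \<longrightarrow> real_class k p) \<and>
           connected E \<and>
           (\<forall>x\<in>E. point_of_rank p r x) \<and>
           (\<exists>U. open U \<and> U \<noteq> {} \<and> U \<subseteq> p ` E)"
proof -
  define M where "M = CARD('m) - r"
  define d where "d = CARD('n) - r"
  have Md: "0 < d" "d < M" using assms by (auto simp: M_def d_def)
  obtain Rm :: "'m set" where Rm: "card Rm = r" using obtain_subset_with_card_n[of r
      "UNIV::'m set"] assms by auto
  obtain Rn :: "'n set" where Rn: "card Rn = r" using obtain_subset_with_card_n[of r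
      "UNIV::'n set"] assms by auto
  obtain \<pi> where \<pi>: "bij_betw \<pi> Rn Rm" using finite_same_card_bij[of Rn Rm] Rm Rn by auto
  have "card (- Rm) = M" "card (- Rn) = d" using Rm Rn
      by (simp_all add: M_def d_def Compl_eq_Diff_UNIV card_Diff_subset)
  then obtain \<tau> idx where \<tau>: "bij_betw \<tau> {..<M} (- Rm)" and idx: "bij_betw idx (- Rn) {..<d}"
    using ex_bij_betw_nat_finite[of "- Rm"] ex_bij_betw_finite_nat[of "- Rn"]
        by (auto simp: lessThan_atLeast0)
  interpret digit_layout \<tau> M using Md \<tau> by unfold_locales (auto simp: bij_betw_def)
  have \<tau>_range: "\<tau> ` {..<M} = - Rm" using \<tau> by (simp add: bij_betw_def)
  define \<kappa> where "\<kappa> = real M / real d"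
  have \<kappa>: "\<kappa> = (real CARD('m) - real r) / (real CARD('n) - real r)" "1 < \<kappa>"
    using assms Md by (simp_all add: \<kappa>_def M_def d_def)
  \<comment> \<open>the partial derivatives of a coordinate function\<close>
  define lin :: "'m list \<Rightarrow> 'm \<Rightarrow> real^'m \<Rightarrow> real" where
    "lin is t x = (if is = [] then x $ t else if is = [t] then 1 else 0)" for "is" t x
  define D :: "'m list \<Rightarrow> real^'m \<Rightarrow> real^'n" where
    "D is x = (\<chi> j. if j \<in> Rn then lin is (\<pi> j) x else readout d (idx j) is x)" for "is" x
  have D_deriv: "(D is has_derivative (\<lambda>h. \<Sum>t\<in>UNIV. h $ t *\<^sub>R D (t # is) x)) (at x)"
    if "real (length is) + 1 < \<kappa>" for "is" x
  proof -
    have "((\<lambda>x. D is x $ j) has_derivative (\<lambda>h. \<Sum>t\<in>UNIV. h $ t * D (t # is) x $ j)) (at x)" for j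
    proof (cases "j \<in> Rn")
      case True
      have s: "(\<Sum>t\<in>UNIV. h $ t * (if t = s then 1 else 0)) = h $ s" for h :: "real^'m" and s
        by (simp add: if_distrib cong: if_cong)
      show ?thesis
      proof (cases "is = []")
        case True
        have "((\<lambda>x. x $ \<pi> j) has_derivative (\<lambda>h. h $ \<pi> j)) (at x)"
          by (rule bounded_linear.has_derivative[OF bounded_linear_vec_nth has_derivative_ident])
        then show ?thesis using \<open>j \<in> Rn\<close> True s by (simp add: D_def lin_def)
      next
        case False
        then show ?thesis using \<open>j \<in> Rn\<close> by (simp add: D_def lin_def)
      qed
    next
      case False
      interpret S: digit_stream "\<lambda>i. place (i * d + idx j)" "\<lambda>i. level (i * d + idx j)"
          "\<lambda>q. 1 / gap_width ((q * d + idx j) div M)" "real M / real d"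
        by (rule stream[OF Md(1)])
      show ?thesis
        using S.series_has_derivative[of "is" x] that False by (simp add: D_def readout_def \<kappa>_def)
    qed
    then show ?thesis
      unfolding has_derivative_componentwise_within[of "D is"]
      by (auto simp: Basis_vec_def inner_axis)
  qed
  have D_cont: "continuous_on UNIV (D is)" if "real (length is) < \<kappa>" for "is"
  proof -
    have "continuous_on UNIV (\<lambda>x. if j \<in> Rn then lin is (\<pi> j) x else readout d (idx j) is x)" for j
    proof (cases "j \<in> Rn")
      case True
      have "continuous_on UNIV (lin is (\<pi> j))" unfolding lin_def[abs_def]
        by (cases "is = []"; cases "is = [\<pi> j]") (auto intro!: continuous_intros)
      then show ?thesis using True by simp
    next
      case False
      interpret S: digit_stream "\<lambda>i. place (i * d + idx j)" "\<lambda>i. level (i * d + idx j)"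
          "\<lambda>q. 1 / gap_width ((q * d + idx j) div M)" "real M / real d"
        by (rule stream[OF Md(1)])
      show ?thesis using S.series_continuous[of "is"] that False by (simp add: readout_def \<kappa>_def)
    qed
    then show ?thesis unfolding D_def[abs_def] by (rule continuous_on_vec_lambda)
  qed
  have D_Hoelder: "\<exists>C. \<forall>x s t. \<bar>s\<bar> \<le> 1 \<longrightarrow> norm (D is (x + s *\<^sub>R axis t 1) - D is x) \<le> C * \<bar>s\<bar> powr \<theta>"
    if \<theta>: "0 \<le> \<theta>" "\<theta> \<le> 1" "real (length is) + \<theta> < \<kappa>" for "is" \<theta>
  proof -
    have "\<exists>C. \<forall>x s t. \<bar>s\<bar> \<le> 1 \<longrightarrow> \<bar>D is (x + s *\<^sub>R axis t 1) $ j - D is x $ j\<bar> \<le> C * \<bar>s\<bar> powr \<theta>" for j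
    proof (cases "j \<in> Rn")
      case True
      have "\<bar>lin is (\<pi> j) (x + s *\<^sub>R axis t 1) - lin is (\<pi> j) x\<bar> \<le> 1 * \<bar>s\<bar> powr \<theta>" if "\<bar>s\<bar> \<le> 1"
          for x s t
      proof -
        have "\<bar>lin is (\<pi> j) (x + s *\<^sub>R axis t 1) - lin is (\<pi> j) x\<bar> \<le> \<bar>s\<bar>"
          by (auto simp: lin_def axis_def)
        also have "\<bar>s\<bar> \<le> \<bar>s\<bar> powr \<theta>"
          using powr_mono'[of \<theta> 1 "\<bar>s\<bar>"] \<theta> that by (cases "s = 0") auto
        finally show ?thesis by simp
      qed
      then show ?thesis using True by (auto simp: D_def intro!: exI[of _ 1])
    next
      case False
      interpret S: digit_stream "\<lambda>i. place (i * d + idx j)" "\<lambda>i. level (i * d + idx j)"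
          "\<lambda>q. 1 / gap_width ((q * d + idx j) div M)" "real M / real d"
        by (rule stream[OF Md(1)])
      obtain C where C: "\<And>x s t. \<bar>S.series is (x + s *\<^sub>R axis t 1) - S.series is x\<bar> \<le> C * \<bar>s\<bar> powr \<theta>"
        using S.series_Hoelder[OF \<theta>(1,2), of "is"] \<theta>(3) unfolding \<kappa>_def by blast
      have "D is x $ j = S.series is x" for x using False by (simp add: D_def readout_def)
      then show ?thesis using C by (intro exI[of _ C]) simp
    qed
    then obtain C where C: "\<And>j x s t. \<bar>s\<bar> \<le> 1
        \<Longrightarrow> \<bar>D is (x + s *\<^sub>R axis t 1) $ j - D is x $ j\<bar> \<le> C j * \<bar>s\<bar> powr \<theta>"
      by metis
    have "norm (D is (x + s *\<^sub>R axis t 1) - D is x) \<le> (\<Sum>j\<in>UNIV. C j) * \<bar>s\<bar> powr \<theta>" if "\<bar>s\<bar> \<le> 1"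
        for x s t
    proof -
      have "norm (D is (x + s *\<^sub>R axis t 1) - D is x) \<le> (\<Sum>j\<in>UNIV. \<bar>(D is (x
          + s *\<^sub>R axis t 1) - D is x) $ j\<bar>)"
        by (rule norm_le_l1_cart)
      also have "\<dots> \<le> (\<Sum>j\<in>UNIV. C j * \<bar>s\<bar> powr \<theta>)"
        using C[OF that] by (intro sum_mono) simp
      finally show ?thesis by (simp add: sum_distrib_right)
    qed
    then show ?thesis by blast
  qed
  have smooth: "real_class k (D [])" if "0 \<le> k" "k < \<kappa>" for k
    by (rule real_class_of_derivative_family[of \<kappa> D, OF D_deriv D_cont D_Hoelder that])
  have critical: "point_of_rank (D []) r x" if "x \<in> critical_set" for x
  proof -
    let ?f = "\<lambda>h::real^'m. (\<chi> j. if j \<in> Rn then h $ \<pi> j else 0) :: real^'n"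
    have "(\<Sum>t\<in>UNIV. h $ t *\<^sub>R D [t] x) = ?f h" for h
    proof -
      have "(\<Sum>t\<in>UNIV. h $ t * D [t] x $ j) = (if j \<in> Rn then h $ \<pi> j else 0)" for j
      proof (cases "j \<in> Rn")
        case True
        have "(\<Sum>t\<in>UNIV. h $ t * D [t] x $ j) = (\<Sum>t\<in>UNIV. if t = \<pi> j then h $ t else 0)"
          using True by (intro sum.cong) (auto simp: D_def lin_def)
        then show ?thesis using True by simp
      next
        case False
        then show ?thesis using readout_partial_critical[OF that Md] by (simp add: D_def)
      qed
      then show ?thesis by (simp add: vec_eq_iff)
    qed
    then have "(D [] has_derivative ?f) (at x)" using D_deriv[of "[]" x] \<kappa>(2) by simp
    then have "D [] differentiable (at x)" "frechet_derivative (D []) (at x) = ?f"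
      by (auto simp: differentiable_def frechet_derivative_at[symmetric])
    moreover have "rank (matrix ?f) = r"
      using rank_coordinate_projection[of \<pi> Rn] \<pi> Rn by (simp add: bij_betw_def)
    ultimately show ?thesis by (simp add: point_of_rank_def jacobian_def)
  qed
  have onto: "{v. \<forall>j. v $ j \<in> {-1<..<1}} \<subseteq> D [] ` critical_set"
  proof
    fix v :: "real^'n" assume "v \<in> {v. \<forall>j. v $ j \<in> {-1<..<1}}"
    then have v: "\<bar>v $ j\<bar> \<le> 1" for j by (auto simp: abs_le_iff less_imp_le)
    have "\<forall>j. \<exists>e. (\<forall>i. trit (e i)) \<and> mirrored_value triadic_len e = v $ j"
        using trit_expansion[OF v] by blast
    then obtain e where e: "\<And>j i. trit (e j i)" "\<And>j. mirrored_value triadic_len (e j) = v $ j" by metis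
    \<comment> \<open>digit number \<open>N\<close> belongs to the target coordinate with index \<open>N mod d\<close>\<close>
  define j\<^sub>N where "j\<^sub>N N = inv_into (- Rn) idx (N mod d)" for N
    obtain x where x: "x \<in> cantor_product" "\<And>N. digit x N = e (j\<^sub>N N) (N div d)"
      "\<And>t. t \<notin> \<tau> ` {..<M} \<Longrightarrow> x $ t = v $ inv_into Rn \<pi> t"
      by (rule cantor_product_with_digits[of "\<lambda>N. e (j\<^sub>N N) (N div d)" "\<lambda>t. v $ inv_into Rn \<pi> t"])
         (use e(1) v in \<open>auto simp: abs_le_iff minus_le_iff\<close>)
    have "D [] x $ j = v $ j" for j
    proof (cases "j \<in> Rn")
      case True
      then have "\<pi> j \<notin> \<tau> ` {..<M}" using \<tau>_range \<pi> by (auto simp: bij_betw_def)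
      then show ?thesis using x(3) True \<pi> by (simp add: D_def lin_def bij_betw_def)
    next
      case False
      then have "idx j < d" "inv_into (- Rn) idx (idx j) = j" using idx by (auto simp: bij_betw_def)
      then have "digit x (i * d + idx j) = e j i" for i using x(2) by (simp add: j\<^sub>N_def)
      then show ?thesis using False readout_cantor_product[OF x(1) Md(1), of "idx j"] e(2)
          by (simp add: D_def)
    qed
    then have "D [] x = v" by (simp add: vec_eq_iff)
    then show "v \<in> D [] ` critical_set" using x(1) cantor_product_subset by blast
  qed
  have cube_open: "open {v :: real^'n. \<forall>j. v $ j \<in> {-1<..<1}}"
  proof -
    have "{v :: real^'n. \<forall>j. v $ j \<in> {-1<..<1}} = box (\<chi> j. -1) (\<chi> j. 1)" by (auto simp: mem_box_cart)
    then show ?thesis by (simp only: open_box)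
  qed
  have cube_nonempty: "{v :: real^'n. \<forall>j. v $ j \<in> {-1<..<1}} \<noteq> {}"
    by (auto intro!: exI[of _ 0])
  show ?thesis
    unfolding \<kappa>(1)[symmetric]
    by (intro exI[of _ "D []"] exI[of _ critical_set] exI[of _ "{v. \<forall>j. v $ j \<in> {-1<..<1}}"]
        conjI allI impI ballI smooth connected_critical_set critical cube_open cube_nonempty onto) blast+
qed

end
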